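(* Let $V$ be a finite set with $|V|=N\ge 1$, let $(Y_k)_{k\in V}$ be a family of real-valued square-integrable random variables admitting a dependency graph of maximal degree $D\in\mathbb{Z}_{\ge 0}$, and let $(c_k)_{k\in V}$ be an arbitrary family of real numbers. Put $S=\sum_{k\in V}Y_k$, $v=\sqrt{\operatorname{Var}[S]}$ and $\mathcal{A}_3=\sum_{k\in V}\mathbb{E}[|Y_k-c_k|^3]$. Assume that $v>0$ and that $\max_{k\in V}\|Y_k-c_k\|_\infty\le L$ for some $L\in(0,\infty)$. Then, with $W=(S-\mathbb{E}[S])/v$, $$d_{\mathrm{Kol}}\left(W,\mathcal{N}(0,1)\right)\le\max\left\{68.5\,\frac{(D+1)^2\mathcal{A}_3}{v^3}\ ,\ 22.88\,\frac{L(D+1)}{v}\right\}.$$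
   Context: A multigraph on $V$ (multiple edges and loops allowed; simple graphs included) is a dependency graph of $(Y_k)_{k\in V}$ if, whenever $V_1,V_2\subset V$ are disjoint and no edge has one endpoint in $V_1$ and the other in $V_2$, the families $(Y_k)_{k\in V_1}$ and $(Y_k)_{k\in V_2}$ are independent. The degree of a vertex is the number of edges it belongs to, and the maximal degree is the maximum over all vertices. The Kolmogorov distance between a real random variable $X$ and the standard normal law is $d_{\mathrm{Kol}}(X,\mathcal{N}(0,1))=\sup_{t\in\mathbb{R}}|\mathbb{P}(X\le t)-\mathbb{P}(G\le t)|$ with $G\sim\mathcal{N}(0,1)$. $\|\cdot\|_\infty$ is the $L^\infty$ (essential supremum) norm of a random variable. *)

theory Defs
  imports "HOL-Probability.Probability" "HOL-Library.Multiset" "HOL-Library.Uprod"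
begin

text \<open>A multigraph on \<open>V\<close> is given by its multiset of edges, each edge being an unordered pair
  of (possibly equal) vertices. Edge multisets are finite; this is no restriction when \<open>V\<close> is
  finite and all degrees are finite.\<close>

definition multigraph_on :: "'k set \<Rightarrow> 'k uprod multiset \<Rightarrow> bool" where
  "multigraph_on V E \<longleftrightarrow> (\<forall>e. e \<in># E \<longrightarrow> set_uprod e \<subseteq> V)"

text \<open>The degree is the number of edges (with multiplicity) that the vertex belongs to, so a loop
  counts once.\<close>

definition mg_degree :: "'k uprod multiset \<Rightarrow> 'k \<Rightarrow> nat" where
  "mg_degree E k = size {# e \<in># E. k \<in> set_uprod e #}"

text \<open>Only meaningful for finite nonempty \<open>V\<close>.\<close>

definition mg_max_degree :: "'k set \<Rightarrow> 'k uprod multiset \<Rightarrow> nat" where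
  "mg_max_degree V E = Max (mg_degree E ` V)"

text \<open>Independence of two families is independence of the corresponding random vectors with
  respect to the product \<open>\<sigma>\<close>-algebras.\<close>

definition dependency_graph ::
    "'a measure \<Rightarrow> 'k set \<Rightarrow> ('k \<Rightarrow> 'a \<Rightarrow> real) \<Rightarrow> 'k uprod multiset \<Rightarrow> bool" where
  "dependency_graph M V Y E \<longleftrightarrow> multigraph_on V E \<and>
     (\<forall>V1 V2. V1 \<subseteq> V \<longrightarrow> V2 \<subseteq> V \<longrightarrow> V1 \<inter> V2 = {} \<longrightarrow>
        \<not> (\<exists>a\<in>V1. \<exists>b\<in>V2. Upair a b \<in># E) \<longrightarrow>
        prob_space.indep_var M
          (PiM V1 (\<lambda>_. borel)) (\<lambda>\<omega>. \<lambda>k\<in>V1. Y k \<omega>)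
          (PiM V2 (\<lambda>_. borel)) (\<lambda>\<omega>. \<lambda>k\<in>V2. Y k \<omega>))"

definition Linf_norm :: "'a measure \<Rightarrow> ('a \<Rightarrow> real) \<Rightarrow> ereal" where
  "Linf_norm M f = esssup M (\<lambda>\<omega>. ereal \<bar>f \<omega>\<bar>)"

text \<open>The distance between the laws \<open>\<mu>\<close> and \<open>\<nu>\<close>; for probability measures the family under the
  supremum is bounded, so the real-valued supremum is the true one.\<close>

definition kolmogorov_distance :: "real measure \<Rightarrow> real measure \<Rightarrow> real" where
  "kolmogorov_distance \<mu> \<nu> = (SUP t. \<bar>cdf \<mu> t - cdf \<nu> t\<bar>)"

end

theory Submission
  imports Defs
begin

text \<open>The proof is an application of Stein's method, using the dependency graph in two ways: to compare
  \<open>W\<close> with a version that is independent of a single summand, and to see that local sums concentrate.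

  After rescaling, let \<open>Z k\<close> be \<open>(Y k - c k) / v\<close>, bounded by \<open>b = L / v\<close>, let \<open>X k\<close> be its centred
  version, so that \<open>W\<close> is the sum of the \<open>X k\<close>, and let \<open>H k\<close> be the sum of \<open>Z\<close> over the closed
  neighbourhood of \<open>k\<close>, which has at most \<open>d = D + 1\<close> vertices. Then \<open>W - H k\<close> is independent of \<open>X k\<close>.
  With \<open>\<delta> = d * b\<close> and \<open>\<eta> = d\<^sup>2 * A\<close>, where \<open>A\<close> is the sum of the third absolute moments of the \<open>Z k\<close>,
  the claim reads \<open>K \<le> max (68.5 * \<eta>) (22.88 * \<delta>)\<close> for the Kolmogorov distance \<open>K\<close>.

  Replace the indicator of \<open>{..z}\<close> by a ramp of width \<open>e\<close> and let \<open>f\<close> solve Stein's equation for the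
  ramp, so that the quantity to estimate is the expectation of \<open>f' W - W * f W\<close>. Because of the
  independence, it equals the expectation of
  \<open>f' W * (1 - Q) + (\<Sum>k. X k * (H k * f' W - (f W - f (W - H k))))\<close> where \<open>Q = (\<Sum>k. X k * H k)\<close>.
  The variable \<open>Q\<close> has mean \<open>1\<close> and variance at most \<open>16 * \<delta> * \<eta>\<close> (\<open>variance_Q_le\<close>), so the first part is
  of order \<open>sqrt (\<delta> * \<eta>)\<close>. The second part is a sum of Taylor remainders, at most
  \<open>T * (2 * \<bar>W\<bar> + 3 + J / e)\<close>, where \<open>T = (\<Sum>k. \<bar>X k\<bar> * (H k)\<^sup>2)\<close> and \<open>J\<close> indicates that \<open>W\<close> is within \<open>\<delta>\<close>
  of the sloping part of the ramp (\<open>stein_solution_ramp\<close>). The mean of \<open>T\<close> is at most \<open>2 * \<eta>\<close> and its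
  variance at most \<open>36 * \<delta>\<^sup>3 * \<eta>\<close> (\<open>expectation_T_le\<close>, \<open>variance_T_le\<close>), which allows \<open>T\<close> to be replaced by
  its mean. The probability of \<open>J\<close> is at most \<open>(e + 2 * \<delta>) / 2 + 2 * K\<close>.

  Altogether (\<open>stein_bound\<close>, \<open>kolmogorov_distance_law_le\<close>) \<open>K\<close> is bounded by a term of order
  \<open>e + \<eta> + sqrt (\<delta> * \<eta>) + sqrt (\<delta>\<^sup>3 * \<eta>) + (\<eta> * \<delta> + sqrt (\<delta>\<^sup>3 * \<eta>)) / e\<close> plus
  \<open>4 * (\<eta> / e) * K\<close>. The claim is trivial unless the maximum of \<open>68.5 * \<eta>\<close> and \<open>22.88 * \<delta>\<close> is less than
  \<open>1\<close>. In that case, choosing \<open>e\<close> as a small multiple of this maximum makes the coefficient of \<open>K\<close> less than \<open>1/5\<close>, while the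
  remaining terms add up to less than \<open>4/5\<close> of the maximum.\<close>

section \<open>Mills' inequalities and Stein's equation\<close>

text \<open>The fundamental theorem of calculus for an infinite lower limit: near \<open>w\<close>, split off the constant
  integral over \<open>{..w - 1}\<close>.\<close>

lemma has_real_derivative_integral_atMost:
  fixes k :: "real \<Rightarrow> real"
  assumes "continuous_on UNIV k" "integrable lborel k"
  shows "((\<lambda>w. LINT x:{..w}|lborel. k x) has_real_derivative k w) (at w)"
proof -
  have si: "set_integrable lborel A k" if "A \<in> sets lborel" for A
    unfolding set_integrable_def by (intro integrable_mult_indicator assms(2) that)
  have eq: "(LINT x:{..u}|lborel. k x) = (LINT x:{..w-1}|lborel. k x) + integral {w-1..u} k"
    if "u \<in> {w-1..w+1}" for u
  proof -
    have "{..u} = {..w-1} \<union> {w-1<..u}" using that by auto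
    then have "(LINT x:{..u}|lborel. k x)
        = (LINT x:{..w-1}|lborel. k x) + (LINT x:{w-1<..u}|lborel. k x)"
      by (simp only:) (intro set_integral_Un si; auto)
    also have "(LINT x:{w-1<..u}|lborel. k x) = (LINT x:{w-1..u}|lborel. k x)"
    proof (rule set_integral_cong_set)
      show "set_borel_measurable lborel {w-1<..u} k" "set_borel_measurable lborel {w-1..u} k"
        using assms(2) unfolding set_borel_measurable_def by auto
      show "AE x in lborel. (x \<in> {w-1..u}) = (x \<in> {w-1<..u})"
        using AE_lborel_singleton[of "w-1"] by eventually_elim auto
    qed
    also have "\<dots> = integral {w-1..u} k"
      by (intro set_borel_integral_eq_integral si) auto
    finally show ?thesis .
  qed
  have "((\<lambda>u. integral {w-1..u} k) has_real_derivative k w) (at w within {w-1..w+1})"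
    by (rule integral_has_real_derivative) (auto intro: continuous_on_subset[OF assms(1)])
  then have "((\<lambda>u. (LINT x:{..w-1}|lborel. k x) + integral {w-1..u} k) has_real_derivative k w)
      (at w within {w-1..w+1})"
    by (auto intro!: derivative_eq_intros)
  then have "((\<lambda>u. LINT x:{..u}|lborel. k x) has_real_derivative k w) (at w within {w-1..w+1})"
    by (rule has_field_derivative_transform_within[of _ _ _ _ 1]) (simp_all only: eq, simp_all)
  then show ?thesis
    by (subst (asm) at_within_interior) auto
qed

abbreviation std_normal_cdf :: "real \<Rightarrow> real" where
  "std_normal_cdf \<equiv> cdf std_normal_distribution"

lemma std_normal_density_le: "std_normal_density w \<le> 1/2"
proof -
  have "sqrt (2 * pi) \<ge> 2"
    using pi_gt3 by (intro real_le_rsqrt) auto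
  then have "1 / sqrt (2 * pi) \<le> 1/2" by (simp add: field_simps)
  moreover have "exp (- w\<^sup>2 / 2) \<le> 1" by simp
  ultimately have "(1 / sqrt (2 * pi)) * exp (- w\<^sup>2 / 2) \<le> 1/2 * 1"
    by (intro mult_mono) auto
  then show ?thesis by (simp add: std_normal_density_def)
qed

text \<open>Mills' inequalities bound the Stein solution by \<open>1 / \<bar>w\<bar>\<close>, hence by \<open>3\<close> outside
  \<open>{-1/3..1/3}\<close>. Inside this interval, where they are useless, \<open>1 / p\<close> is a bound.\<close>

lemma inverse_std_normal_density_le:
  assumes "\<bar>w\<bar> \<le> 1/3" shows "1 / std_normal_density w \<le> 3"
proof -
  have "w\<^sup>2 \<le> (1/3)\<^sup>2" using assms by (metis abs_ge_zero power2_abs power_mono)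
  then have "w\<^sup>2/2 \<le> 1/18" by (simp add: power2_eq_square)
  then have e: "exp (- w\<^sup>2 / 2) \<ge> 17/18"
    using exp_ge_add_one_self[of "- w\<^sup>2 / 2"] by linarith
  have "sqrt (2 * pi) \<le> 2.6"
    using pi_less_4 pi_approx by (intro real_le_lsqrt) (auto simp: power2_eq_square)
  then have "sqrt (2 * pi) \<le> 3 * exp (- w\<^sup>2 / 2)" using e by linarith
  then show ?thesis
    by (simp add: std_normal_density_def field_simps)
qed

lemma std_normal_density_has_derivative:
  "(std_normal_density has_real_derivative - w * std_normal_density w) (at w)"
  unfolding std_normal_density_def[abs_def]
  by (auto intro!: derivative_eq_intros simp: field_simps)

lemma std_normal_cdf_eq:
  "std_normal_cdf w = (LINT x:{..w}|lborel. std_normal_density x)"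
proof -
  have "std_normal_cdf w = (LINT x|std_normal_distribution. indicator {..w} x)"
    by (simp add: cdf_def)
  also have "\<dots> = (LINT x|lborel. std_normal_density x * indicator {..w} x)"
    by (subst integral_density) auto
  finally show ?thesis by (simp add: set_lebesgue_integral_def mult.commute)
qed

lemma std_normal_cdf_has_derivative:
  "(std_normal_cdf has_real_derivative std_normal_density w) (at w)"
  unfolding std_normal_cdf_eq[abs_def]
proof (rule has_real_derivative_integral_atMost)
  show "continuous_on UNIV std_normal_density"
    by (auto simp: std_normal_density_def intro!: continuous_intros)
qed simp

interpretation std_normal: real_distribution std_normal_distribution
  by (rule real_dist_normal_dist)

lemma std_normal_cdf_diff_le:
  assumes "0 \<le> s" shows "std_normal_cdf (z + s) - std_normal_cdf z \<le> s / 2"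
proof (cases "s = 0")
  case False
  with assms have "z < z + s" by simp
  then obtain x where "std_normal_cdf (z + s) - std_normal_cdf z = (z + s - z) * std_normal_density x"
    using MVT2[of z "z+s" std_normal_cdf std_normal_density] std_normal_cdf_has_derivative by blast
  also have "\<dots> \<le> s * (1/2)"
    using assms std_normal_density_le[of x] by (simp only: add_diff_cancel_left') (rule mult_left_mono)
  finally show ?thesis by simp
qed simp

text \<open>Mills' inequality for the left tail. The function \<open>p x / (- x) - \<Phi> x\<close> has derivative
  \<open>p x / x\<^sup>2 \<ge> 0\<close> on the negative axis and vanishes at \<open>-\<infinity>\<close>, so it is nonnegative there.\<close>

lemma std_normal_mills_left:
  assumes "w < 0" shows "- w * std_normal_cdf w \<le> std_normal_density w"
proof -
  let ?u = "\<lambda>x. std_normal_density x * (1 / - x) - std_normal_cdf x"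
  have mono: "?u x \<le> ?u w" if "x \<le> w" for x
  proof (rule DERIV_nonneg_imp_nondecreasing[OF that])
    fix y assume "x \<le> y" "y \<le> w"
    then have "y < 0" using assms by simp
    then have "(?u has_real_derivative std_normal_density y / y\<^sup>2) (at y)"
      by (auto intro!: derivative_eq_intros std_normal_density_has_derivative std_normal_cdf_has_derivative
          simp: power2_eq_square field_simps)
    then show "\<exists>d. (?u has_real_derivative d) (at y) \<and> 0 \<le> d"
      by (intro exI[of _ "std_normal_density y / y\<^sup>2"] conjI) auto
  qed
  have "((\<lambda>x. std_normal_density x * (1 / - x)) \<longlongrightarrow> 0) at_bot"
  proof (rule Lim_null_comparison)
    show "((\<lambda>x::real. 1 / - x) \<longlongrightarrow> 0) at_bot" by real_asymp
    show "\<forall>\<^sub>F x in at_bot. norm (std_normal_density x * (1 / - x)) \<le> 1 / - x"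
      using eventually_le_at_bot[of "-1 :: real"]
    proof eventually_elim
      case (elim x)
      have "std_normal_density x * (1 / - x) \<le> 1 * (1 / - x)"
        using elim std_normal_density_le[of x] by (intro mult_right_mono) auto
      then have "std_normal_density x * (1 / - x) \<le> 1 / - x" by simp
      moreover have "std_normal_density x * (1 / - x) \<ge> 0"
        using elim by (intro mult_nonneg_nonneg) auto
      ultimately show ?case by (simp only: real_norm_def abs_of_nonneg)
    qed
  qed
  from tendsto_diff[OF this std_normal.cdf_lim_at_bot] have "(?u \<longlongrightarrow> 0) at_bot" by simp
  then have "0 \<le> ?u w"
    by (rule tendsto_upperbound) (rule eventually_mono[OF eventually_le_at_bot[of w]], erule mono, simp)
  then show ?thesis using assms by (simp add: field_simps)
qed

text \<open>The mirror image: \<open>p x / x - (1 - \<Phi> x)\<close> decreases to \<open>0\<close> at \<open>+\<infinity>\<close>.\<close>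

lemma std_normal_mills_right:
  assumes "w > 0" shows "w * (1 - std_normal_cdf w) \<le> std_normal_density w"
proof -
  let ?u = "\<lambda>x. std_normal_density x * (1 / x) - (1 - std_normal_cdf x)"
  have mono: "?u x \<le> ?u w" if "w \<le> x" for x
  proof (rule DERIV_nonpos_imp_nonincreasing[OF that])
    fix y assume "w \<le> y" "y \<le> x"
    then have "y > 0" using assms by simp
    then have "(?u has_real_derivative - std_normal_density y / y\<^sup>2) (at y)"
      by (auto intro!: derivative_eq_intros std_normal_density_has_derivative std_normal_cdf_has_derivative
          simp: power2_eq_square field_simps)
    then show "\<exists>d. (?u has_real_derivative d) (at y) \<and> d \<le> 0"
      by (intro exI[of _ "- std_normal_density y / y\<^sup>2"] conjI) auto
  qed
  have "((\<lambda>x. std_normal_density x * (1 / x)) \<longlongrightarrow> 0) at_top"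
  proof (rule Lim_null_comparison)
    show "((\<lambda>x::real. 1 / x) \<longlongrightarrow> 0) at_top" by real_asymp
    show "\<forall>\<^sub>F x in at_top. norm (std_normal_density x * (1 / x)) \<le> 1 / x"
      using eventually_gt_at_top[of 0]
    proof eventually_elim
      case (elim x)
      have "std_normal_density x * (1 / x) \<le> 1 * (1 / x)"
        using elim std_normal_density_le[of x] by (intro mult_right_mono) auto
      then have "std_normal_density x * (1 / x) \<le> 1 / x" by simp
      moreover have "std_normal_density x * (1 / x) \<ge> 0"
        using elim by (intro mult_nonneg_nonneg) auto
      ultimately show ?case by (simp only: real_norm_def abs_of_nonneg)
    qed
  qed
  from tendsto_diff[OF this tendsto_diff[OF tendsto_const[of 1] std_normal.cdf_lim_at_top_prob]]
  have "(?u \<longlongrightarrow> 0) at_top" by simp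
  then have "0 \<le> ?u w"
    by (rule tendsto_upperbound) (rule eventually_mono[OF eventually_ge_at_top[of w]], erule mono, simp)
  then show ?thesis using assms by (simp add: field_simps)
qed

text \<open>Stein's equation \<open>f' w - w * f w = g w\<close> for a bounded continuous \<open>g\<close> of Gaussian mean zero.
  With \<open>G w\<close> the integral of \<open>g p\<close> over \<open>{..w}\<close>, the quotient \<open>f = G / p\<close> is a solution because
  \<open>p' w = - w * p w\<close>. As the total integral of \<open>g p\<close> is zero, \<open>G\<close> is bounded by the smaller of the
  two tails of the normal law, and Mills' inequalities turn this into bounds on \<open>f\<close> and \<open>w * f w\<close>.
  The constant \<open>3\<close> is not sharp.\<close>

lemma stein_solution:
  fixes g :: "real \<Rightarrow> real"
  assumes cont: "continuous_on UNIV g" and bnd: "\<And>x. \<bar>g x\<bar> \<le> 1"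
    and mean0: "(LINT x|lborel. g x * std_normal_density x) = 0"
  obtains f where "\<And>w. (f has_real_derivative w * f w + g w) (at w)"
    and "\<And>w. \<bar>f w\<bar> \<le> 3" and "\<And>w. \<bar>w * f w\<bar> \<le> 1"
proof -
  let ?p = std_normal_density and ?P = std_normal_cdf
  have [measurable]: "g \<in> borel_measurable borel"
    by (rule borel_measurable_continuous_onI[OF cont])
  have intp: "integrable lborel ?p" by simp
  have int: "integrable lborel (\<lambda>x. g x * ?p x)"
  proof (rule Bochner_Integration.integrable_bound[OF intp])
    show "AE x in lborel. norm (g x * ?p x) \<le> norm (?p x)"
      using bnd by (auto simp: abs_mult intro!: mult_left_le_one_le)
  qed auto
  have si: "set_integrable lborel A (\<lambda>x. g x * ?p x)" "set_integrable lborel A ?p"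
    if "A \<in> sets lborel" for A
    using int intp that unfolding set_integrable_def
    by (auto intro: integrable_mult_indicator simp del: real_scaleR_def)
  define G where "G w = (LINT x:{..w}|lborel. g x * ?p x)" for w
  define f where "f w = G w / ?p w" for w
  have bound: "\<bar>LINT x:A|lborel. g x * ?p x\<bar> \<le> (LINT x:A|lborel. ?p x)" if "A \<in> sets lborel" for A
  proof -
    have "\<bar>LINT x:A|lborel. g x * ?p x\<bar> \<le> (LINT x:A|lborel. \<bar>g x * ?p x\<bar>)"
      using set_integral_norm_bound[OF si(1)[OF that]] by simp
    also have "\<dots> \<le> (LINT x:A|lborel. ?p x)"
      using bnd
      by (intro set_integral_mono si that set_integrable_abs)
         (auto simp: abs_mult intro!: mult_left_le_one_le)
    finally show ?thesis .
  qed
  have split: "(LINT x|lborel. k x) = (LINT x:{..w}|lborel. k x) + (LINT x:{w<..}|lborel. k x)"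
    if k: "integrable lborel k" for k :: "real \<Rightarrow> real" and w
  proof -
    have "(LINT x|lborel. k x) = (LINT x:{..w} \<union> {w<..}|lborel. k x)"
    proof -
      have "{..w} \<union> {w<..} = UNIV" by auto
      then show ?thesis by (simp add: set_lebesgue_integral_def)
    qed
    also have "\<dots> = (LINT x:{..w}|lborel. k x) + (LINT x:{w<..}|lborel. k x)"
      using k by (intro set_integral_Un)
        (auto simp: set_integrable_def intro: integrable_mult_indicator simp del: real_scaleR_def)
    finally show ?thesis .
  qed
  have G1: "\<bar>G w\<bar> \<le> ?P w" for w
    using bound[of "{..w}"] by (simp add: G_def std_normal_cdf_eq)
  \<comment> \<open>The mean zero condition allows the integral over the left tail to be traded for the right one.\<close>
  have G2: "\<bar>G w\<bar> \<le> 1 - ?P w" for w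
  proof -
    have "G w = - (LINT x:{w<..}|lborel. g x * ?p x)"
      using split[OF int, of w] mean0 by (simp add: G_def)
    then have "\<bar>G w\<bar> \<le> (LINT x:{w<..}|lborel. ?p x)"
      using bound[of "{w<..}"] by simp
    also have "\<dots> = 1 - ?P w"
      using split[OF intp, of w] by (simp add: std_normal_cdf_eq)
    finally show ?thesis .
  qed
  have pos: "?p w > 0" for w by (rule normal_density_pos) simp
  have wf: "\<bar>w * f w\<bar> \<le> 1" for w
  proof -
    have "\<bar>w\<bar> * \<bar>G w\<bar> \<le> ?p w"
    proof (cases "w < 0")
      case True
      then show ?thesis
        using order_trans[OF mult_left_mono[OF G1[of w], of "-w"] std_normal_mills_left[OF True]] by simp
    next
      case False
      then show ?thesis
        using order_trans[OF mult_left_mono[OF G2[of w], of w] std_normal_mills_right[of w]]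
        by (cases "w = 0") auto
    qed
    then show ?thesis using pos[of w] by (simp add: f_def abs_mult field_simps)
  qed
  have f3: "\<bar>f w\<bar> \<le> 3" for w
  proof (cases "\<bar>w\<bar> \<le> 1/3")
    case True
    have "\<bar>f w\<bar> = \<bar>G w\<bar> * (1 / ?p w)" using pos[of w] by (simp add: f_def abs_mult)
    also have "\<dots> \<le> 1 * 3"
      using inverse_std_normal_density_le[OF True] G1[of w] std_normal.cdf_bounded_prob[of w]
      by (intro mult_mono) auto
    finally show ?thesis by simp
  next
    case False
    have "1/3 * \<bar>f w\<bar> \<le> \<bar>w\<bar> * \<bar>f w\<bar>" using False by (intro mult_right_mono) auto
    also have "\<dots> \<le> 1" using wf[of w] by (simp add: abs_mult)
    finally show ?thesis by simp
  qed
  have "(f has_real_derivative w * f w + g w) (at w)" for w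
  proof -
    have "continuous_on UNIV ?p"
      by (auto simp: std_normal_density_def intro!: continuous_intros)
    then have "(G has_real_derivative g w * ?p w) (at w)"
      unfolding G_def by (intro has_real_derivative_integral_atMost int continuous_intros cont)
    then show ?thesis
      unfolding f_def[abs_def]
      using pos[of w]
      by (auto intro!: derivative_eq_intros std_normal_density_has_derivative
          simp: field_simps power2_eq_square simp del: normal_density_pos)
  qed
  from that[OF this f3 wf] show thesis .
qed

section \<open>Stein solutions for smoothed indicators\<close>

text \<open>A Lipschitz version of the indicator of \<open>{..z}\<close>: it is \<open>1\<close> up to \<open>z\<close> and falls linearly
  to \<open>0\<close> on \<open>{z..z + e}\<close>.\<close>

definition ramp :: "real \<Rightarrow> real \<Rightarrow> real \<Rightarrow> real" where
  "ramp z e x = max 0 (min 1 ((z + e - x) / e))"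

lemma ramp_bounds: "0 \<le> ramp z e x" "ramp z e x \<le> 1"
  by (auto simp: ramp_def)

lemma continuous_on_ramp: "e > 0 \<Longrightarrow> continuous_on A (ramp z e)"
  unfolding ramp_def[abs_def] by (intro continuous_intros) auto

lemma borel_measurable_ramp [measurable]: "ramp z e \<in> borel_measurable borel"
  unfolding ramp_def[abs_def] by measurable

lemma ramp_le_indicator: "e > 0 \<Longrightarrow> ramp z e x \<le> indicator {..z + e} x"
  by (auto simp: ramp_def indicator_def field_simps)

lemma indicator_le_ramp: "e > 0 \<Longrightarrow> indicator {..z} x \<le> ramp z e x"
  by (auto simp: ramp_def indicator_def field_simps)

text \<open>The Lipschitz constant \<open>1 / e\<close> is large, but it only counts near the sloping part. Keeping the
  indicator is essential: the probability that \<open>W\<close> falls into this window is again of the order of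
  the window's length plus the Kolmogorov distance.\<close>

lemma ramp_local_lipschitz:
  assumes "e > 0" "\<bar>t\<bar> \<le> \<delta>"
  shows "\<bar>ramp z e w - ramp z e (w - t)\<bar> \<le> \<bar>t\<bar> * (indicator {z - \<delta>..z + e + \<delta>} w / e)"
proof (cases "w \<in> {z - \<delta>..z + e + \<delta>}")
  case True
  have "\<bar>ramp z e w - ramp z e (w - t)\<bar> \<le> \<bar>(z + e - w) / e - (z + e - (w - t)) / e\<bar>"
  proof -
    have "\<bar>max 0 (min 1 u) - max 0 (min 1 v)\<bar> \<le> \<bar>u - v\<bar>" for u v :: real
      by linarith
    then show ?thesis unfolding ramp_def .
  qed
  also have "\<dots> = \<bar>t\<bar> / e"
    using assms(1) by (simp add: diff_divide_distrib[symmetric])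
  finally show ?thesis using True by simp
next
  case False
  then have "w < z - \<delta> \<or> w > z + e + \<delta>" by auto
  then consider "w \<le> z" "w - t \<le> z" | "w \<ge> z + e" "w - t \<ge> z + e"
    using assms by linarith
  then have "ramp z e w = ramp z e (w - t)"
    using assms(1) by cases (simp_all add: ramp_def field_simps)
  then show ?thesis using False by simp
qed

definition ramp_mean :: "real \<Rightarrow> real \<Rightarrow> real" where
  "ramp_mean z e = (LINT x|std_normal_distribution. ramp z e x)"

lemma integrable_ramp: "integrable std_normal_distribution (ramp z e)"
  by (rule std_normal.integrable_const_bound[of _ 1]) (auto simp: ramp_bounds)

lemma ramp_mean_bounds:
  assumes "e > 0"
  shows "std_normal_cdf z \<le> ramp_mean z e" "ramp_mean z e \<le> std_normal_cdf (z + e)"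
proof -
  have i: "integrable std_normal_distribution (indicator {..t} :: real \<Rightarrow> real)" for t
    by (rule std_normal.integrable_const_bound[of _ 1]) auto
  have eq: "std_normal_cdf t = (LINT x|std_normal_distribution. indicator {..t} x)" for t
    by (simp add: cdf_def)
  show "std_normal_cdf z \<le> ramp_mean z e" "ramp_mean z e \<le> std_normal_cdf (z + e)"
    unfolding eq ramp_mean_def
    by (rule integral_mono[OF i integrable_ramp indicator_le_ramp[OF assms]],
        rule integral_mono[OF integrable_ramp i ramp_le_indicator[OF assms]])
qed

lemma mean_value_backward:
  fixes f f' :: "real \<Rightarrow> real"
  assumes "\<And>w. (f has_real_derivative f' w) (at w)"
  obtains s where "\<bar>s\<bar> \<le> \<bar>t\<bar>" "f w - f (w - t) = t * f' (w - s)"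
proof -
  consider "t = 0" | "t > 0" | "t < 0" by linarith
  then show thesis
  proof cases
    case 1
    then show ?thesis using that[of 0] by simp
  next
    case 2
    then obtain x where "w - t < x" "x < w" "f w - f (w - t) = (w - (w - t)) * f' x"
      using MVT2[of "w - t" w f f'] assms by auto
    then show ?thesis using that[of "w - x"] by auto
  next
    case 3
    then obtain x where "w < x" "x < w - t" "f (w - t) - f w = (w - t - w) * f' x"
      using MVT2[of w "w - t" f f'] assms by auto
    then show ?thesis using that[of "w - x"] by auto
  qed
qed

text \<open>The last bound is the second order Taylor estimate for the Stein solution. By the mean value
  theorem it reduces to the increments of \<open>f' w = w * f w + ramp z e w - ramp_mean z e\<close>: the product
  \<open>w * f w\<close> contributes \<open>2 * \<bar>w\<bar> + 3\<close> per unit length since \<open>\<bar>f'\<bar> \<le> 2\<close> and \<open>\<bar>f\<bar> \<le> 3\<close>, and the ramp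
  contributes \<open>1 / e\<close> on its window.\<close>

lemma stein_solution_ramp:
  assumes "e > 0"
  obtains f f' where "\<And>w. (f has_real_derivative f' w) (at w)"
    and "\<And>w. f' w = w * f w + (ramp z e w - ramp_mean z e)"
    and "\<And>w. \<bar>f w\<bar> \<le> 3" and "\<And>w. \<bar>f' w\<bar> \<le> 2"
    and "\<And>w t \<delta>. \<bar>t\<bar> \<le> \<delta> \<Longrightarrow> \<bar>t * f' w - (f w - f (w - t))\<bar>
           \<le> t\<^sup>2 * (2 * \<bar>w\<bar> + 3 + indicator {z - \<delta>..z + e + \<delta>} w / e)"
proof -
  define g where "g x = ramp z e x - ramp_mean z e" for x
  have m: "0 \<le> ramp_mean z e" "ramp_mean z e \<le> 1"
    using ramp_mean_bounds[OF assms, of z] std_normal.cdf_nonneg[of z]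
      std_normal.cdf_bounded_prob[of "z + e"] by linarith+
  have g1: "\<bar>g x\<bar> \<le> 1" for x
    using m ramp_bounds[of z e x] unfolding g_def by (auto simp: abs_le_iff)
  have "continuous_on UNIV g"
    unfolding g_def by (intro continuous_intros continuous_on_ramp assms)
  moreover have "(LINT x|lborel. g x * std_normal_density x) = 0"
  proof -
    have "(LINT x|lborel. g x * std_normal_density x) = (LINT x|std_normal_distribution. g x)"
      unfolding g_def by (subst integral_density) (auto simp: mult.commute)
    also have "\<dots> = 0"
      unfolding g_def using integrable_ramp std_normal.prob_space by (simp add: ramp_mean_def)
    finally show ?thesis .
  qed
  ultimately obtain f where f: "\<And>w. (f has_real_derivative w * f w + g w) (at w)"
    and f3: "\<And>w. \<bar>f w\<bar> \<le> 3" and wf: "\<And>w. \<bar>w * f w\<bar> \<le> 1"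
    using stein_solution[of g] g1 by blast
  define f' where "f' w = w * f w + g w" for w
  have df: "(f has_real_derivative f' w) (at w)" for w using f by (simp add: f'_def)
  have f2: "\<bar>f' w\<bar> \<le> 2" for w using wf[of w] g1[of w] unfolding f'_def by linarith
  have "\<bar>t * f' w - (f w - f (w - t))\<bar>
       \<le> t\<^sup>2 * (2 * \<bar>w\<bar> + 3 + indicator {z - \<delta>..z + e + \<delta>} w / e)" if t: "\<bar>t\<bar> \<le> \<delta>" for w t \<delta>
  proof -
    obtain s where s: "\<bar>s\<bar> \<le> \<bar>t\<bar>" "f w - f (w - t) = t * f' (w - s)"
      using mean_value_backward[OF df] by blast
    obtain r where r: "f w - f (w - s) = s * f' (w - r)"
      using mean_value_backward[OF df] by blast
    let ?J = "indicator {z - \<delta>..z + e + \<delta>} w / e"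
    have "f' w - f' (w - s) = w * (s * f' (w - r)) + s * f (w - s) + (ramp z e w - ramp z e (w - s))"
      using arg_cong[OF r, of "\<lambda>x. w * x"] unfolding f'_def[of w] f'_def[of "w - s"] g_def
      by (simp add: algebra_simps)
    also have "\<bar>\<dots>\<bar> \<le> \<bar>w * (s * f' (w - r))\<bar> + \<bar>s * f (w - s)\<bar> + \<bar>ramp z e w - ramp z e (w - s)\<bar>"
      by linarith
    also have "\<dots> \<le> \<bar>w\<bar> * (\<bar>s\<bar> * 2) + \<bar>s\<bar> * 3 + \<bar>s\<bar> * ?J"
      unfolding abs_mult using f2 f3 s(1) t
      by (intro add_mono mult_left_mono ramp_local_lipschitz assms) auto
    also have "\<dots> = \<bar>s\<bar> * (2 * \<bar>w\<bar> + 3 + ?J)" by (simp add: algebra_simps)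
    also have "\<dots> \<le> \<bar>t\<bar> * (2 * \<bar>w\<bar> + 3 + ?J)"
      using s(1) assms by (intro mult_right_mono) auto
    finally have *: "\<bar>f' w - f' (w - s)\<bar> \<le> \<bar>t\<bar> * (2 * \<bar>w\<bar> + 3 + ?J)" .
    have "\<bar>t * f' w - (f w - f (w - t))\<bar> = \<bar>t\<bar> * \<bar>f' w - f' (w - s)\<bar>"
      unfolding s(2) by (simp add: abs_mult[symmetric] algebra_simps)
    also have "\<dots> \<le> \<bar>t\<bar> * (\<bar>t\<bar> * (2 * \<bar>w\<bar> + 3 + ?J))"
      by (intro mult_left_mono *) auto
    also have "\<dots> = t\<^sup>2 * (2 * \<bar>w\<bar> + 3 + ?J)"
      by (metis ab_semigroup_mult_class.mult_ac(1) power2_abs power2_eq_square)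
    finally show ?thesis .
  qed
  from that[OF df _ f3 f2 this] show thesis by (simp add: f'_def g_def)
qed

text \<open>The Cauchy-Schwarz inequality, in the form in which upper bounds for both second moments are
  given. It follows from \<open>2 * \<bar>U * G\<bar> \<le> U\<^sup>2 / \<sigma> + \<sigma> * G\<^sup>2\<close>.\<close>

lemma (in prob_space) expectation_mult_le:
  fixes U G :: "'a \<Rightarrow> real"
  assumes "U \<in> borel_measurable M" "G \<in> borel_measurable M"
    and "integrable M (\<lambda>x. (U x)\<^sup>2)" "integrable M (\<lambda>x. (G x)\<^sup>2)"
    and "expectation (\<lambda>x. (U x)\<^sup>2) \<le> \<sigma>\<^sup>2" "expectation (\<lambda>x. (G x)\<^sup>2) \<le> 1" "\<sigma> > 0"
  shows "\<bar>expectation (\<lambda>x. U x * G x)\<bar> \<le> \<sigma>"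
proof -
  have pt: "\<bar>U x * G x\<bar> \<le> ((U x)\<^sup>2 / \<sigma> + \<sigma> * (G x)\<^sup>2) / 2" for x
  proof -
    have "0 \<le> (\<bar>U x\<bar> - \<sigma> * \<bar>G x\<bar>)\<^sup>2" by simp
    then have "2 * \<sigma> * (\<bar>U x\<bar> * \<bar>G x\<bar>) \<le> (U x)\<^sup>2 + \<sigma>\<^sup>2 * (G x)\<^sup>2"
      by (simp add: power2_diff power_mult_distrib algebra_simps)
    then show ?thesis using assms(7) by (simp add: abs_mult field_simps power2_eq_square)
  qed
  have int: "integrable M (\<lambda>x. ((U x)\<^sup>2 / \<sigma> + \<sigma> * (G x)\<^sup>2) / 2)" using assms by simp
  have "\<bar>expectation (\<lambda>x. U x * G x)\<bar> \<le> expectation (\<lambda>x. \<bar>U x * G x\<bar>)"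
    by (rule integral_abs_bound)
  also have "\<dots> \<le> expectation (\<lambda>x. ((U x)\<^sup>2 / \<sigma> + \<sigma> * (G x)\<^sup>2) / 2)"
    using assms(7) by (intro integral_mono' int pt) auto
  also have "\<dots> = (expectation (\<lambda>x. (U x)\<^sup>2) / \<sigma> + \<sigma> * expectation (\<lambda>x. (G x)\<^sup>2)) / 2"
    using assms(3,4) by simp
  also have "\<dots> \<le> (\<sigma>\<^sup>2 / \<sigma> + \<sigma> * 1) / 2"
    using assms(5-7) by (intro divide_right_mono add_mono mult_left_mono) auto
  also have "\<dots> = \<sigma>" using assms(7) by (simp add: power2_eq_square)
  finally show ?thesis .
qed

section \<open>Variances of local sums\<close>

text \<open>The set \<open>N k\<close> is the closed neighbourhood of the vertex \<open>k\<close>, so that \<open>d\<close> bounds the maximal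
  degree plus one, and the independence axiom says that the families over two sets without common
  vertices and without edges between them are independent. The variables are bounded at every
  point, which makes all integrability questions trivial.\<close>

locale bounded_dependency = prob_space M for M :: "'a measure" +
  fixes V :: "'k set" and N :: "'k \<Rightarrow> 'k set" and d b :: real and Z :: "'k \<Rightarrow> 'a \<Rightarrow> real"
  assumes finite_V: "finite V"
    and N_sub: "k \<in> V \<Longrightarrow> N k \<subseteq> V"
    and N_refl: "k \<in> V \<Longrightarrow> k \<in> N k"
    and N_sym: "k \<in> V \<Longrightarrow> j \<in> N k \<Longrightarrow> k \<in> N j"
    and N_card: "k \<in> V \<Longrightarrow> real (card (N k)) \<le> d"
    and Z_measurable: "k \<in> V \<Longrightarrow> Z k \<in> borel_measurable M"
    and Z_bound: "k \<in> V \<Longrightarrow> \<bar>Z k \<omega>\<bar> \<le> b"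
    and Z_indep: "A \<subseteq> V \<Longrightarrow> B \<subseteq> V \<Longrightarrow> (\<And>p. p \<in> A \<Longrightarrow> N p \<inter> B = {}) \<Longrightarrow>
      indep_var (PiM A (\<lambda>_. borel)) (\<lambda>\<omega>. \<lambda>k\<in>A. Z k \<omega>) (PiM B (\<lambda>_. borel)) (\<lambda>\<omega>. \<lambda>k\<in>B. Z k \<omega>)"
begin

lemma finite_N: "k \<in> V \<Longrightarrow> finite (N k)"
  using finite_V N_sub finite_subset by blast

text \<open>Independence is inherited by functions of the coordinates in a block of vertices. This predicate
  records that a random variable is such a function; its closure properties replace explicit
  measurability arguments on product spaces.\<close>

definition determined_by :: "'k set \<Rightarrow> ('a \<Rightarrow> real) \<Rightarrow> bool" where
  "determined_by A U \<longleftrightarrow> (\<exists>F \<in> borel_measurable (PiM A (\<lambda>_. borel)). U = (\<lambda>\<omega>. F (\<lambda>k\<in>A. Z k \<omega>)))"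

lemma determined_by_Z: "k \<in> A \<Longrightarrow> determined_by A (Z k)"
  unfolding determined_by_def
  by (intro bexI[of _ "\<lambda>x. x k"]) (auto intro: measurable_component_singleton)

lemma determined_by_compose:
  assumes "determined_by A U" "g \<in> borel_measurable borel"
  shows "determined_by A (\<lambda>\<omega>. g (U \<omega>))"
proof -
  obtain F where [measurable]: "F \<in> borel_measurable (PiM A (\<lambda>_. borel))"
    and U: "U = (\<lambda>\<omega>. F (\<lambda>k\<in>A. Z k \<omega>))"
    using assms(1) unfolding determined_by_def by auto
  note assms(2)[measurable]
  show ?thesis unfolding determined_by_def
    by (intro bexI[of _ "\<lambda>x. g (F x)"]) (auto simp: U)
qed

lemma determined_by_mult:
  assumes "determined_by A U" "determined_by A U'"
  shows "determined_by A (\<lambda>\<omega>. U \<omega> * U' \<omega>)"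
proof -
  obtain F F' where [measurable]: "F \<in> borel_measurable (PiM A (\<lambda>_. borel))"
      "F' \<in> borel_measurable (PiM A (\<lambda>_. borel))"
    and U: "U = (\<lambda>\<omega>. F (\<lambda>k\<in>A. Z k \<omega>))" "U' = (\<lambda>\<omega>. F' (\<lambda>k\<in>A. Z k \<omega>))"
    using assms unfolding determined_by_def by auto
  show ?thesis unfolding determined_by_def
    by (intro bexI[of _ "\<lambda>x. F x * F' x"]) (auto simp: U)
qed

lemma determined_by_sum_Z: "B \<subseteq> A \<Longrightarrow> determined_by A (\<lambda>\<omega>. \<Sum>k\<in>B. Z k \<omega>)"
proof -
  assume B: "B \<subseteq> A"
  have "(\<lambda>x. \<Sum>k\<in>B. x k) \<in> borel_measurable (PiM A (\<lambda>_. borel :: real measure))"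
    using B by (intro borel_measurable_sum measurable_component_singleton) auto
  moreover have "(\<lambda>\<omega>. \<Sum>k\<in>B. Z k \<omega>) = (\<lambda>\<omega>. (\<lambda>x. \<Sum>k\<in>B. x k) (\<lambda>k\<in>A. Z k \<omega>))"
    using B by (intro ext sum.cong) auto
  ultimately show ?thesis
    unfolding determined_by_def by (intro bexI[of _ "\<lambda>x. \<Sum>k\<in>B. x k"])
qed

lemma determined_by_measurable:
  assumes "determined_by A U" "A \<subseteq> V"
  shows "U \<in> borel_measurable M"
proof -
  obtain F where [measurable]: "F \<in> borel_measurable (PiM A (\<lambda>_. borel))"
    and U: "U = (\<lambda>\<omega>. F (\<lambda>k\<in>A. Z k \<omega>))"
    using assms(1) unfolding determined_by_def by auto
  have "(\<lambda>\<omega>. \<lambda>k\<in>A. Z k \<omega>) \<in> measurable M (PiM A (\<lambda>_. borel))"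
    using assms(2) Z_measurable by (intro measurable_restrict) auto
  then show ?thesis unfolding U by measurable
qed

lemma expectation_mult_separated:
  assumes "determined_by A U" "determined_by B U'" "A \<subseteq> V" "B \<subseteq> V"
    and "\<And>p. p \<in> A \<Longrightarrow> N p \<inter> B = {}"
    and "integrable M U" "integrable M U'"
  shows "expectation (\<lambda>\<omega>. U \<omega> * U' \<omega>) = expectation U * expectation U'"
proof -
  obtain F F' where F: "F \<in> borel_measurable (PiM A (\<lambda>_. borel))"
      "F' \<in> borel_measurable (PiM B (\<lambda>_. borel))"
    and U: "U = (\<lambda>\<omega>. F (\<lambda>k\<in>A. Z k \<omega>))" "U' = (\<lambda>\<omega>. F' (\<lambda>k\<in>B. Z k \<omega>))"
    using assms(1,2) unfolding determined_by_def by auto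
  have "indep_var borel (F \<circ> (\<lambda>\<omega>. \<lambda>k\<in>A. Z k \<omega>)) borel (F' \<circ> (\<lambda>\<omega>. \<lambda>k\<in>B. Z k \<omega>))"
    by (rule indep_var_compose[OF Z_indep[OF assms(3,4)] F]) (rule assms(5))
  then have "indep_var borel U borel U'" by (simp add: U o_def)
  then show ?thesis by (rule indep_var_lebesgue_integral) (fact assms)+
qed

lemma bounded_integrable:
  fixes U :: "'a \<Rightarrow> real"
  assumes "U \<in> borel_measurable M" "\<And>\<omega>. \<bar>U \<omega>\<bar> \<le> C"
  shows "integrable M U"
  using assms by (intro integrable_const_bound[of _ C]) auto

text \<open>The variance of a sum of functions of small blocks. The covariance of \<open>U i\<close> and \<open>U j\<close> vanishes
  unless some vertex of \<open>B i\<close> has a neighbour in \<open>B j\<close>, and otherwise it is at most the mean of the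
  two second moments. For a given \<open>i\<close> there are at most \<open>r * d * s\<close> such \<open>j\<close>: choose a vertex of
  \<open>B i\<close>, then a neighbour of it, then a block containing that neighbour.\<close>

lemma variance_block_sum:
  fixes U :: "'i \<Rightarrow> 'a \<Rightarrow> real" and B :: "'i \<Rightarrow> 'k set" and r s C :: real
  assumes fin: "finite I"
    and det: "\<And>i. i \<in> I \<Longrightarrow> determined_by (B i) (U i)"
    and B: "\<And>i. i \<in> I \<Longrightarrow> B i \<subseteq> V" "\<And>i. i \<in> I \<Longrightarrow> real (card (B i)) \<le> r"
    and bnd: "\<And>i \<omega>. i \<in> I \<Longrightarrow> \<bar>U i \<omega>\<bar> \<le> C"
    and cnt: "\<And>q. q \<in> V \<Longrightarrow> real (card {i \<in> I. q \<in> B i}) \<le> s"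
    and nonneg: "0 \<le> d" "0 \<le> s"
  shows "variance (\<lambda>\<omega>. \<Sum>i\<in>I. U i \<omega>) \<le> r * d * s * (\<Sum>i\<in>I. expectation (\<lambda>\<omega>. (U i \<omega>)\<^sup>2))"
proof -
  define R where "R i j \<longleftrightarrow> (\<exists>p\<in>B i. N p \<inter> B j \<noteq> {})" for i j
  define X where "X i \<omega> = U i \<omega> - expectation (U i)" for i \<omega>
  define e where "e i = expectation (\<lambda>\<omega>. (U i \<omega>)\<^sup>2)" for i
  have meas: "U i \<in> borel_measurable M" if "i \<in> I" for i
    using determined_by_measurable[OF det B(1)] that by blast
  have intU: "integrable M (U i)" if "i \<in> I" for i
    using bounded_integrable[OF meas bnd] that by blast
  have intU2: "integrable M (\<lambda>\<omega>. (U i \<omega>)\<^sup>2)" if "i \<in> I" for i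
  proof (rule bounded_integrable)
    show "(\<lambda>\<omega>. (U i \<omega>)\<^sup>2) \<in> borel_measurable M" using meas[OF that] by measurable
    show "\<bar>(U i \<omega>)\<^sup>2\<bar> \<le> C\<^sup>2" for \<omega>
      using power_mono[OF bnd[OF that], of \<omega> 2] by simp
  qed
  have measX: "X i \<in> borel_measurable M" if "i \<in> I" for i
    unfolding X_def using meas[OF that] by measurable
  have bndX: "\<bar>X i \<omega>\<bar> \<le> C + \<bar>expectation (U i)\<bar>" if "i \<in> I" for i \<omega>
    using bnd[OF that, of \<omega>] unfolding X_def by linarith
  have intX: "integrable M (X i)" if "i \<in> I" for i
    using bounded_integrable[OF measX bndX] that by blast
  have intXX: "integrable M (\<lambda>\<omega>. X i \<omega> * X j \<omega>)" if "i \<in> I" "j \<in> I" for i j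
  proof (rule bounded_integrable)
    show "(\<lambda>\<omega>. X i \<omega> * X j \<omega>) \<in> borel_measurable M" using measX that by measurable
    show "\<bar>X i \<omega> * X j \<omega>\<bar> \<le> (C + \<bar>expectation (U i)\<bar>) * (C + \<bar>expectation (U j)\<bar>)" for \<omega>
      unfolding abs_mult using bndX[OF that(1), of \<omega>] bndX[OF that(2), of \<omega>]
      by (intro mult_mono) auto
  qed
  have EX: "expectation (X i) = 0" if "i \<in> I" for i
    unfolding X_def using intU[OF that] prob_space by simp
  have X2: "expectation (\<lambda>\<omega>. (X i \<omega>)\<^sup>2) \<le> e i" if "i \<in> I" for i
    using variance_eq[OF intU[OF that] intU2[OF that]] unfolding X_def e_def by simp
  have cov: "expectation (\<lambda>\<omega>. X i \<omega> * X j \<omega>) \<le> (if R i j then (e i + e j) / 2 else 0)"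
    if ij: "i \<in> I" "j \<in> I" for i j
  proof (cases "R i j")
    case True
    have int2: "integrable M (\<lambda>\<omega>. (X i \<omega>)\<^sup>2)" if "i \<in> I" for i
      using intXX[OF that that] by (simp add: power2_eq_square)
    have "expectation (\<lambda>\<omega>. X i \<omega> * X j \<omega>) \<le> expectation (\<lambda>\<omega>. ((X i \<omega>)\<^sup>2 + (X j \<omega>)\<^sup>2) / 2)"
    proof (rule integral_mono[OF intXX[OF ij]])
      show "integrable M (\<lambda>\<omega>. ((X i \<omega>)\<^sup>2 + (X j \<omega>)\<^sup>2) / 2)" using int2 ij by simp
      show "X i \<omega> * X j \<omega> \<le> ((X i \<omega>)\<^sup>2 + (X j \<omega>)\<^sup>2) / 2" for \<omega>
        using sum_squares_bound[of "X i \<omega>" "X j \<omega>"] by simp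
    qed
    also have "\<dots> = (expectation (\<lambda>\<omega>. (X i \<omega>)\<^sup>2) + expectation (\<lambda>\<omega>. (X j \<omega>)\<^sup>2)) / 2"
      using int2 ij by simp
    also have "\<dots> \<le> (e i + e j) / 2" using X2 ij by (intro divide_right_mono add_mono) auto
    finally show ?thesis using True by simp
  next
    case False
    have "determined_by (B k) (X k)" if "k \<in> I" for k
      unfolding X_def
      by (rule determined_by_compose[OF det[OF that], of "\<lambda>x. x - expectation (U k)"]) measurable
    then have "expectation (\<lambda>\<omega>. X i \<omega> * X j \<omega>) = expectation (X i) * expectation (X j)"
      using False ij intX by (intro expectation_mult_separated[of "B i" _ "B j"] B(1)) (auto simp: R_def)
    then show ?thesis using EX ij False by simp
  qed
  have Rsym: "R j i" if R: "R i j" and i: "i \<in> I" for i j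
  proof -
    obtain p q where "p \<in> B i" "q \<in> N p" "q \<in> B j" using R unfolding R_def by blast
    then show ?thesis unfolding R_def using N_sym B(1)[OF i] by blast
  qed
  have cardR: "real (card {j \<in> I. R i j}) \<le> r * d * s" if i: "i \<in> I" for i
  proof -
    have finB: "finite (B i)" using B(1)[OF i] finite_V finite_subset by blast
    \<comment> \<open>The blocks linked to \<open>B i\<close>, sorted by the linking pair of vertices.\<close>
    have "{j \<in> I. R i j} = (\<Union>p\<in>B i. \<Union>q\<in>N p. {j \<in> I. q \<in> B j})"
      unfolding R_def by blast
    then have "card {j \<in> I. R i j} \<le> (\<Sum>p\<in>B i. card (\<Union>q\<in>N p. {j \<in> I. q \<in> B j}))"
      using card_UN_le[OF finB] by simp
    also have "\<dots> \<le> (\<Sum>p\<in>B i. \<Sum>q\<in>N p. card {j \<in> I. q \<in> B j})"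
      using B(1)[OF i] by (intro sum_mono card_UN_le finite_N) auto
    finally have "real (card {j \<in> I. R i j}) \<le> (\<Sum>p\<in>B i. \<Sum>q\<in>N p. real (card {j \<in> I. q \<in> B j}))"
      by (metis (mono_tags, lifting) of_nat_le_iff of_nat_sum sum.cong)
    also have "\<dots> \<le> (\<Sum>p\<in>B i. \<Sum>q\<in>N p. s)"
      using B(1)[OF i] N_sub by (intro sum_mono cnt) blast
    also have "\<dots> = (\<Sum>p\<in>B i. real (card (N p)) * s)" by simp
    also have "\<dots> \<le> (\<Sum>p\<in>B i. d * s)"
      using B(1)[OF i] nonneg by (intro sum_mono mult_right_mono N_card) auto
    also have "\<dots> = real (card (B i)) * (d * s)" by simp
    also have "\<dots> \<le> r * (d * s)" using nonneg by (intro mult_right_mono B(2) i) auto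
    finally show ?thesis by simp
  qed
  have e0: "e i \<ge> 0" for i unfolding e_def by simp
  have "expectation (\<lambda>\<omega>. \<Sum>i\<in>I. U i \<omega>) = (\<Sum>i\<in>I. expectation (U i))"
    by (intro Bochner_Integration.integral_sum intU)
  then have "variance (\<lambda>\<omega>. \<Sum>i\<in>I. U i \<omega>) = expectation (\<lambda>\<omega>. (\<Sum>i\<in>I. X i \<omega>)\<^sup>2)"
    by (simp add: X_def sum_subtractf)
  also have "\<dots> = expectation (\<lambda>\<omega>. \<Sum>i\<in>I. \<Sum>j\<in>I. X i \<omega> * X j \<omega>)"
    by (simp add: power2_eq_square sum_product)
  also have "\<dots> = (\<Sum>i\<in>I. \<Sum>j\<in>I. expectation (\<lambda>\<omega>. X i \<omega> * X j \<omega>))"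
    using intXX by (subst Bochner_Integration.integral_sum) auto
  also have "\<dots> \<le> (\<Sum>i\<in>I. \<Sum>j\<in>I. if R i j then (e i + e j) / 2 else 0)"
    by (intro sum_mono cov)
  also have "\<dots> = ((\<Sum>i\<in>I. \<Sum>j\<in>I. if R i j then e i else 0) + (\<Sum>i\<in>I. \<Sum>j\<in>I. if R i j then e j else 0)) / 2"
    by (simp add: sum.distrib[symmetric] sum_divide_distrib if_distrib cong: if_cong) (intro sum.cong; simp)
  also have "(\<Sum>i\<in>I. \<Sum>j\<in>I. if R i j then e j else 0) = (\<Sum>j\<in>I. \<Sum>i\<in>I. if R j i then e j else 0)"
    by (subst sum.swap) (use Rsym in \<open>intro sum.cong; auto\<close>)
  also have "((\<Sum>i\<in>I. \<Sum>j\<in>I. if R i j then e i else 0) + (\<Sum>j\<in>I. \<Sum>i\<in>I. if R j i then e j else 0)) / 2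
      = (\<Sum>i\<in>I. \<Sum>j\<in>I. if R i j then e i else 0)" by simp
  also have "\<dots> = (\<Sum>i\<in>I. real (card {j \<in> I. R i j}) * e i)"
    using fin by (intro sum.cong) (auto simp: sum.If_cases Int_def)
  also have "\<dots> \<le> (\<Sum>i\<in>I. r * d * s * e i)"
    using e0 by (intro sum_mono mult_right_mono cardR) auto
  finally show ?thesis by (simp add: e_def sum_distrib_left)
qed

end

section \<open>Moments of pair and triple sums\<close>

text \<open>This is the factorisation of \<open>p\<^sup>3 + q\<^sup>3 + r\<^sup>3 - 3 * p * q * r\<close>, whose quadratic factor is half a sum
  of squares.\<close>

lemma abs_triple_product_le:
  fixes x y z :: real
  shows "\<bar>x\<bar> * \<bar>y\<bar> * \<bar>z\<bar> \<le> (\<bar>x\<bar> ^ 3 + \<bar>y\<bar> ^ 3 + \<bar>z\<bar> ^ 3) / 3"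
proof -
  define p q r where "p = \<bar>x\<bar>" "q = \<bar>y\<bar>" "r = \<bar>z\<bar>"
  have "0 \<le> (p + q + r) * ((p - q)\<^sup>2 + (q - r)\<^sup>2 + (r - p)\<^sup>2)"
    by (intro mult_nonneg_nonneg add_nonneg_nonneg) (auto simp: p_q_r_def)
  then show ?thesis
    unfolding p_q_r_def[symmetric] by (simp add: power2_eq_square power3_eq_cube algebra_simps)
qed

text \<open>Jensen's inequality for the cube, from the tangent line of \<open>x\<^sup>3\<close> at the mean.\<close>

lemma (in prob_space) expectation_abs_power3_le:
  fixes U :: "'a \<Rightarrow> real"
  assumes "integrable M U" "integrable M (\<lambda>x. \<bar>U x\<bar> ^ 3)"
  shows "(expectation (\<lambda>x. \<bar>U x\<bar>)) ^ 3 \<le> expectation (\<lambda>x. \<bar>U x\<bar> ^ 3)"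
proof -
  define y where "y = expectation (\<lambda>x. \<bar>U x\<bar>)"
  have y0: "y \<ge> 0" unfolding y_def by simp
  have "y ^ 3 = expectation (\<lambda>x. y ^ 3 + 3 * y\<^sup>2 * (\<bar>U x\<bar> - y))"
    using assms(1) prob_space by (simp add: y_def)
  also have "\<dots> \<le> expectation (\<lambda>x. \<bar>U x\<bar> ^ 3)"
  proof (rule integral_mono)
    show "integrable M (\<lambda>x. y ^ 3 + 3 * y\<^sup>2 * (\<bar>U x\<bar> - y))" using assms(1) by simp
    show "y ^ 3 + 3 * y\<^sup>2 * (\<bar>U x\<bar> - y) \<le> \<bar>U x\<bar> ^ 3" for x
    proof -
      have "0 \<le> (\<bar>U x\<bar> - y)\<^sup>2 * (\<bar>U x\<bar> + 2 * y)" using y0 by simp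
      then show ?thesis by (simp add: power2_eq_square power3_eq_cube algebra_simps)
    qed
  qed (fact assms)
  finally show ?thesis unfolding y_def .
qed

context bounded_dependency begin

text \<open>Only the first factor of the local products below is centred: the reference points
  subtracted from the original variables need not be their means, and third moments about the
  means could be larger. Uncentred neighbours are enough, because changing them by constants does
  not affect independence.\<close>

definition X :: "'k \<Rightarrow> 'a \<Rightarrow> real" where "X k \<omega> = Z k \<omega> - expectation (Z k)"

definition a :: "'k \<Rightarrow> real" where "a k = expectation (\<lambda>\<omega>. \<bar>Z k \<omega>\<bar> ^ 3)"

definition A where "A = (\<Sum>k\<in>V. a k)"

lemma a_nonneg: "0 \<le> a k" and A_nonneg: "0 \<le> A"
  by (auto simp: a_def A_def intro: sum_nonneg)

lemma integrable_Z: "k \<in> V \<Longrightarrow> integrable M (Z k)"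
  using bounded_integrable[OF Z_measurable Z_bound] .

lemma integrable_Z3:
  assumes "k \<in> V" shows "integrable M (\<lambda>\<omega>. \<bar>Z k \<omega>\<bar> ^ 3)"
proof (rule bounded_integrable)
  note Z_measurable[OF assms, measurable]
  show "(\<lambda>\<omega>. \<bar>Z k \<omega>\<bar> ^ 3) \<in> borel_measurable M" by measurable
  show "\<bar>\<bar>Z k \<omega>\<bar> ^ 3\<bar> \<le> b ^ 3" for \<omega>
    using power_mono[OF Z_bound[OF assms, of \<omega>], of 3] by (simp add: power_abs)
qed

lemma b_nonneg: "k \<in> V \<Longrightarrow> 0 \<le> b"
  using Z_bound[of k undefined] by linarith

lemma X_measurable: "k \<in> V \<Longrightarrow> X k \<in> borel_measurable M"
  unfolding X_def[abs_def] using Z_measurable by measurable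

lemma X_bound: assumes "k \<in> V" shows "\<bar>X k \<omega>\<bar> \<le> 2 * b"
proof -
  have "\<bar>expectation (Z k)\<bar> \<le> expectation (\<lambda>\<omega>. \<bar>Z k \<omega>\<bar>)" by (rule integral_abs_bound)
  also have "\<dots> \<le> expectation (\<lambda>\<omega>. b)"
    using integrable_Z[OF assms] Z_bound[OF assms] by (intro integral_mono) auto
  finally have "\<bar>expectation (Z k)\<bar> \<le> b" using prob_space by simp
  then show ?thesis using Z_bound[OF assms, of \<omega>] unfolding X_def by linarith
qed

lemma expectation_X: "k \<in> V \<Longrightarrow> expectation (X k) = 0"
  unfolding X_def[abs_def] using integrable_Z prob_space by simp

lemma determined_by_X: "k \<in> B \<Longrightarrow> determined_by B (X k)"
  unfolding X_def[abs_def]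
  by (rule determined_by_compose[OF determined_by_Z, of k B "\<lambda>x. x - expectation (Z k)"]) measurable

lemma triple_product_bound:
  assumes "k \<in> V" "i \<in> V" "j \<in> V"
  shows "\<bar>X k \<omega>\<bar> * \<bar>Z i \<omega>\<bar> * \<bar>Z j \<omega>\<bar> \<le> 2 * b * b * b"
  using X_bound[of k \<omega>] Z_bound[of i \<omega>] Z_bound[of j \<omega>] b_nonneg[of k] assms
  by (auto intro!: mult_mono)

lemma integrable_triple_product:
  assumes "k \<in> V" "i \<in> V" "j \<in> V"
  shows "integrable M (\<lambda>\<omega>. \<bar>X k \<omega>\<bar> * \<bar>Z i \<omega>\<bar> * \<bar>Z j \<omega>\<bar>)"
proof -
  note [measurable] = Z_measurable[OF assms(2)] Z_measurable[OF assms(3)] X_measurable[OF assms(1)]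
  show ?thesis
    using triple_product_bound[OF assms]
    by (intro bounded_integrable[of _ "2 * b * b * b"]) (auto simp: abs_mult)
qed

text \<open>Since \<open>\<bar>X k\<bar> \<le> \<bar>Z k\<bar> + E \<bar>Z k\<bar>\<close>, centring the first factor only costs a factor \<open>2\<close> over the
  inequality between the geometric and the arithmetic mean.\<close>

lemma expectation_triple_product_le:
  assumes "k \<in> V" "i \<in> V" "j \<in> V"
  shows "expectation (\<lambda>\<omega>. \<bar>X k \<omega>\<bar> * \<bar>Z i \<omega>\<bar> * \<bar>Z j \<omega>\<bar>) \<le> 2 / 3 * (a k + a i + a j)"
proof -
  note [measurable] = Z_measurable[OF assms(1)] Z_measurable[OF assms(2)] Z_measurable[OF assms(3)]
  note int3 = integrable_Z3[OF assms(1)] integrable_Z3[OF assms(2)] integrable_Z3[OF assms(3)]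
  define y where "y = expectation (\<lambda>\<omega>. \<bar>Z k \<omega>\<bar>)"
  have y0: "y \<ge> 0" unfolding y_def by simp
  have y3: "y ^ 3 \<le> a k"
    unfolding y_def a_def by (intro expectation_abs_power3_le integrable_Z integrable_Z3 assms)
  have ey: "\<bar>expectation (Z k)\<bar> \<le> y" unfolding y_def by (rule integral_abs_bound)
  let ?r = "\<lambda>\<omega>. (\<bar>Z k \<omega>\<bar> ^ 3 + \<bar>Z i \<omega>\<bar> ^ 3 + \<bar>Z j \<omega>\<bar> ^ 3) / 3 + (y ^ 3 + \<bar>Z i \<omega>\<bar> ^ 3 + \<bar>Z j \<omega>\<bar> ^ 3) / 3"
  have intr: "integrable M ?r" using int3 by simp
  have "expectation (\<lambda>\<omega>. \<bar>X k \<omega>\<bar> * \<bar>Z i \<omega>\<bar> * \<bar>Z j \<omega>\<bar>) \<le> expectation ?r"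
  proof (rule integral_mono'[OF intr])
    fix \<omega>
    have "\<bar>X k \<omega>\<bar> \<le> \<bar>Z k \<omega>\<bar> + \<bar>y\<bar>" using ey y0 unfolding X_def by linarith
    then have "\<bar>X k \<omega>\<bar> * (\<bar>Z i \<omega>\<bar> * \<bar>Z j \<omega>\<bar>) \<le> (\<bar>Z k \<omega>\<bar> + \<bar>y\<bar>) * (\<bar>Z i \<omega>\<bar> * \<bar>Z j \<omega>\<bar>)"
      by (intro mult_right_mono) auto
    also have "\<dots> = \<bar>Z k \<omega>\<bar> * \<bar>Z i \<omega>\<bar> * \<bar>Z j \<omega>\<bar> + \<bar>y\<bar> * \<bar>Z i \<omega>\<bar> * \<bar>Z j \<omega>\<bar>"
      by (simp add: algebra_simps)
    also have "\<dots> \<le> ?r \<omega>"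
      using abs_triple_product_le[of "Z k \<omega>" "Z i \<omega>" "Z j \<omega>"]
        abs_triple_product_le[of y "Z i \<omega>" "Z j \<omega>"]
      unfolding abs_of_nonneg[OF y0] by linarith
    finally show "\<bar>X k \<omega>\<bar> * \<bar>Z i \<omega>\<bar> * \<bar>Z j \<omega>\<bar> \<le> ?r \<omega>" by (simp add: mult.assoc)
    show "0 \<le> ?r \<omega>" using y0 by simp
  qed
  also have "\<dots> = (a k + a i + a j) / 3 + (y ^ 3 + a i + a j) / 3"
    using int3 prob_space by (simp add: a_def)
  also have "\<dots> \<le> 2 / 3 * (a k + a i + a j)"
    using y3 by (simp add: field_simps)
  finally show ?thesis .
qed

text \<open>By symmetry of the neighbourhoods, every vertex occurs at most \<open>d\<close> times as a neighbour.\<close>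

lemma sum_neighbours_le:
  assumes "\<And>k. 0 \<le> (F k :: real)"
  shows "(\<Sum>k\<in>V. \<Sum>j\<in>N k. F k) \<le> d * (\<Sum>k\<in>V. F k)"
    and "(\<Sum>k\<in>V. \<Sum>j\<in>N k. F j) \<le> d * (\<Sum>k\<in>V. F k)"
proof -
  have "(\<Sum>k\<in>V. \<Sum>j\<in>N k. F k) = (\<Sum>k\<in>V. real (card (N k)) * F k)" by simp
  also have "\<dots> \<le> (\<Sum>k\<in>V. d * F k)"
    using assms by (intro sum_mono mult_right_mono N_card) auto
  finally show 1: "(\<Sum>k\<in>V. \<Sum>j\<in>N k. F k) \<le> d * (\<Sum>k\<in>V. F k)" by (simp add: sum_distrib_left)
  have "(\<Sum>k\<in>V. \<Sum>j\<in>N k. F j) = (\<Sum>k\<in>V. \<Sum>j\<in>{j\<in>V. j \<in> N k}. F j)"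
    using N_sub by (intro sum.cong) auto
  also have "\<dots> = (\<Sum>j\<in>V. \<Sum>k\<in>{k\<in>V. j \<in> N k}. F j)"
    by (rule sum.swap_restrict) (auto intro: finite_V)
  also have "\<dots> = (\<Sum>j\<in>V. \<Sum>k\<in>N j. F j)"
    using N_sub N_sym by (intro sum.cong) auto
  finally show "(\<Sum>k\<in>V. \<Sum>j\<in>N k. F j) \<le> d * (\<Sum>k\<in>V. F k)" using 1 by simp
qed

lemma d_nonneg: "k \<in> V \<Longrightarrow> 0 \<le> d"
  using N_card[of k] by (metis of_nat_0_le_iff order_trans)

text \<open>The two local statistics of the proof: \<open>Q\<close> is the sum of \<open>X k * H k\<close> and \<open>T\<close> is the sum of
  \<open>\<bar>X k\<bar> * (H k)\<^sup>2\<close>, where \<open>H k\<close> is the sum of \<open>Z\<close> over the neighbourhood of \<open>k\<close>. Written over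
  pairs and triples of vertices, they become sums over blocks of two and three vertices, which gives
  variances of the right order in \<open>d\<close>; taking whole neighbourhoods as blocks would lose powers of
  \<open>d\<close>.\<close>

definition pairs where "pairs = Sigma V N"
definition triples where "triples = Sigma V (\<lambda>k. N k \<times> N k)"

definition Q where "Q \<omega> = (\<Sum>(k, j)\<in>pairs. X k \<omega> * Z j \<omega>)"
definition T where "T \<omega> = (\<Sum>(k, i, j)\<in>triples. \<bar>X k \<omega>\<bar> * (Z i \<omega> * Z j \<omega>))"

lemma finite_pairs: "finite pairs" and finite_triples: "finite triples"
  unfolding pairs_def triples_def using finite_V finite_N by auto

lemma sum_triples_le:
  assumes "V \<noteq> {}"
  shows "(\<Sum>(k, i, j)\<in>triples. a k + a i + a j) \<le> 3 * d\<^sup>2 * A"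
proof -
  have d0: "d \<ge> 0" using assms d_nonneg by blast
  have c: "(\<Sum>k\<in>V. \<Sum>i\<in>N k. \<Sum>j\<in>N k. F i k) \<le> d * (\<Sum>k\<in>V. \<Sum>i\<in>N k. F i k)"
    if "\<And>i k. 0 \<le> (F i k :: real)" for F
  proof -
    have "(\<Sum>k\<in>V. \<Sum>i\<in>N k. \<Sum>j\<in>N k. F i k) = (\<Sum>k\<in>V. real (card (N k)) * (\<Sum>i\<in>N k. F i k))"
      by (simp add: sum_distrib_left)
    also have "\<dots> \<le> (\<Sum>k\<in>V. d * (\<Sum>i\<in>N k. F i k))"
      using that by (intro sum_mono mult_right_mono N_card sum_nonneg) auto
    finally show ?thesis by (simp add: sum_distrib_left)
  qed
  note S = sum_neighbours_le[of a, OF a_nonneg]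
  have 1: "(\<Sum>k\<in>V. \<Sum>i\<in>N k. \<Sum>j\<in>N k. a k) \<le> d * (d * A)"
    using c[of "\<lambda>i k. a k"] mult_left_mono[OF S(1) d0] a_nonneg unfolding A_def by fastforce
  have 2: "(\<Sum>k\<in>V. \<Sum>i\<in>N k. \<Sum>j\<in>N k. a i) \<le> d * (d * A)"
    using c[of "\<lambda>i k. a i"] mult_left_mono[OF S(2) d0] a_nonneg unfolding A_def by fastforce
  have 3: "(\<Sum>k\<in>V. \<Sum>i\<in>N k. \<Sum>j\<in>N k. a j) \<le> d * (d * A)"
    using 2 by (subst sum.swap)
  have "(\<Sum>(k, i, j)\<in>triples. a k + a i + a j) = (\<Sum>k\<in>V. \<Sum>(i, j)\<in>N k \<times> N k. a k + a i + a j)"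
    unfolding triples_def using finite_V finite_N by (subst sum.Sigma) auto
  also have "\<dots> = (\<Sum>k\<in>V. \<Sum>i\<in>N k. \<Sum>j\<in>N k. a k + a i + a j)"
    by (simp add: sum.cartesian_product)
  also have "\<dots> = (\<Sum>k\<in>V. \<Sum>i\<in>N k. \<Sum>j\<in>N k. a k) + (\<Sum>k\<in>V. \<Sum>i\<in>N k. \<Sum>j\<in>N k. a i)
      + (\<Sum>k\<in>V. \<Sum>i\<in>N k. \<Sum>j\<in>N k. a j)"
    by (simp only: sum.distrib)
  finally show ?thesis using 1 2 3 by (simp add: power2_eq_square algebra_simps)
qed

lemma sum_pairs_le:
  "(\<Sum>(k, j)\<in>pairs. a k + a j + a j) \<le> 3 * d * A"
proof -
  note S = sum_neighbours_le[of a, OF a_nonneg]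
  have "(\<Sum>(k, j)\<in>pairs. a k + a j + a j) = (\<Sum>k\<in>V. \<Sum>j\<in>N k. a k + a j + a j)"
    unfolding pairs_def using finite_V finite_N by (subst sum.Sigma) auto
  also have "\<dots> = (\<Sum>k\<in>V. \<Sum>j\<in>N k. a k) + (\<Sum>k\<in>V. \<Sum>j\<in>N k. a j) + (\<Sum>k\<in>V. \<Sum>j\<in>N k. a j)"
    by (simp only: sum.distrib)
  finally show ?thesis using S unfolding A_def[symmetric] by simp
qed

text \<open>Here the blocks have two vertices and each vertex lies in at most \<open>2 * d\<close> of them. One factor
  \<open>\<bar>X k\<bar> \<le> 2 * b\<close> is taken out of the fourth order moments, leaving third order ones.\<close>

lemma variance_Q_le:
  assumes "V \<noteq> {}"
  shows "variance Q \<le> 16 * d ^ 3 * b * A"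
proof -
  have d0: "d \<ge> 0" using assms d_nonneg by blast
  have b0: "b \<ge> 0" using assms b_nonneg by blast
  have sub: "k \<in> V \<Longrightarrow> i \<in> N k \<Longrightarrow> i \<in> V" for k i using N_sub by blast
  let ?U = "\<lambda>(k, j) \<omega>. X k \<omega> * Z j \<omega>" and ?B = "\<lambda>(k, j). {k, j}"
  have Q: "Q = (\<lambda>\<omega>. \<Sum>i\<in>pairs. ?U i \<omega>)"
    unfolding Q_def[abs_def] by (intro ext sum.cong) auto
  have "variance Q \<le> 2 * d * (2 * d) * (\<Sum>i\<in>pairs. expectation (\<lambda>\<omega>. (?U i \<omega>)\<^sup>2))"
    unfolding Q
  proof (rule variance_block_sum[where B = ?B and C = "2 * b * b"])
    fix i assume "i \<in> pairs"
    then obtain k j where i: "i = (k, j)" "k \<in> V" "j \<in> N k" "j \<in> V"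
      unfolding pairs_def using sub by auto
    show "determined_by (?B i) (?U i)"
      using i by (auto intro!: determined_by_mult determined_by_X determined_by_Z)
    show "?B i \<subseteq> V" using i by auto
    show "real (card (?B i)) \<le> 2" using i by (auto simp: card_insert_if)
    show "\<bar>?U i \<omega>\<bar> \<le> 2 * b * b" for \<omega>
      using i X_bound[of k \<omega>] Z_bound[of j \<omega>] b0 by (auto simp: abs_mult intro!: mult_mono)
  next
    fix q assume q: "q \<in> V"
    have "{i \<in> pairs. q \<in> ?B i} \<subseteq> {q} \<times> N q \<union> N q \<times> {q}"
      unfolding pairs_def using N_sym by auto
    then have "card {i \<in> pairs. q \<in> ?B i} \<le> card ({q} \<times> N q \<union> N q \<times> {q})"
      using finite_N[OF q] by (intro card_mono) auto
    also have "\<dots> \<le> card ({q} \<times> N q) + card (N q \<times> {q})" by (rule card_Un_le)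
    also have "\<dots> = 2 * card (N q)" by (simp add: card_cartesian_product)
    finally show "real (card {i \<in> pairs. q \<in> ?B i}) \<le> 2 * d"
      using N_card[OF q] by linarith
  qed (use finite_pairs d0 in auto)
  also have "(\<Sum>i\<in>pairs. expectation (\<lambda>\<omega>. (?U i \<omega>)\<^sup>2))
      \<le> (\<Sum>i\<in>pairs. 4 / 3 * b * (case i of (k, j) \<Rightarrow> a k + a j + a j))"
  proof (rule sum_mono)
    fix i assume "i \<in> pairs"
    then obtain k j where i: "i = (k, j)" "k \<in> V" "j \<in> V"
      unfolding pairs_def using sub by auto
    have "integrable M (\<lambda>\<omega>. \<bar>X k \<omega>\<bar> * \<bar>Z j \<omega>\<bar> * \<bar>Z j \<omega>\<bar>)"
      by (rule integrable_triple_product[OF i(2,3,3)])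
    then have "expectation (\<lambda>\<omega>. (X k \<omega> * Z j \<omega>)\<^sup>2)
        \<le> expectation (\<lambda>\<omega>. 2 * b * (\<bar>X k \<omega>\<bar> * \<bar>Z j \<omega>\<bar> * \<bar>Z j \<omega>\<bar>))"
    proof (intro integral_mono')
      fix \<omega>
      have "(X k \<omega> * Z j \<omega>)\<^sup>2 = \<bar>X k \<omega>\<bar> * (\<bar>X k \<omega>\<bar> * \<bar>Z j \<omega>\<bar> * \<bar>Z j \<omega>\<bar>)"
        by (simp add: power2_eq_square mult.assoc mult.left_commute)
      also have "\<dots> \<le> 2 * b * (\<bar>X k \<omega>\<bar> * \<bar>Z j \<omega>\<bar> * \<bar>Z j \<omega>\<bar>)"
        using X_bound[OF i(2)] by (intro mult_right_mono) auto
      finally show "(X k \<omega> * Z j \<omega>)\<^sup>2 \<le> 2 * b * (\<bar>X k \<omega>\<bar> * \<bar>Z j \<omega>\<bar> * \<bar>Z j \<omega>\<bar>)" .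
    qed (use b0 in auto)
    also have "\<dots> = 2 * b * expectation (\<lambda>\<omega>. \<bar>X k \<omega>\<bar> * \<bar>Z j \<omega>\<bar> * \<bar>Z j \<omega>\<bar>)" by simp
    also have "\<dots> \<le> 2 * b * (2 / 3 * (a k + a j + a j))"
      using i b0 by (intro mult_left_mono expectation_triple_product_le) auto
    finally show "expectation (\<lambda>\<omega>. (?U i \<omega>)\<^sup>2) \<le> 4 / 3 * b * (case i of (k, j) \<Rightarrow> a k + a j + a j)"
      by (simp add: i algebra_simps)
  qed
  also have "\<dots> = 4 / 3 * b * (\<Sum>(k, j)\<in>pairs. a k + a j + a j)" by (simp add: sum_distrib_left)
  also have "\<dots> \<le> 4 / 3 * b * (3 * d * A)"
    using b0 by (intro mult_left_mono sum_pairs_le) auto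
  finally have "variance Q \<le> 2 * d * (2 * d) * (4 / 3 * b * (3 * d * A))"
    using d0 by (simp add: mult_left_mono)
  also have "\<dots> = 16 * d ^ 3 * b * A"
    by (simp add: power3_eq_cube)
  finally show ?thesis .
qed

lemma expectation_T_le:
  assumes "V \<noteq> {}"
  shows "expectation T \<le> 2 * d\<^sup>2 * A"
proof -
  have sub: "k \<in> V \<Longrightarrow> i \<in> N k \<Longrightarrow> i \<in> V" for k i using N_sub by blast
  have 1: "integrable M (\<lambda>\<omega>. \<bar>X k \<omega>\<bar> * (Z i \<omega> * Z j \<omega>)) \<and>
      expectation (\<lambda>\<omega>. \<bar>X k \<omega>\<bar> * (Z i \<omega> * Z j \<omega>)) \<le> 2 / 3 * (a k + a i + a j)"
    if "k \<in> V" "i \<in> V" "j \<in> V" for i j k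
  proof -
    note [measurable] = Z_measurable[OF that(2)] Z_measurable[OF that(3)] X_measurable[OF that(1)]
    have i1: "integrable M (\<lambda>\<omega>. \<bar>X k \<omega>\<bar> * (Z i \<omega> * Z j \<omega>))"
      using triple_product_bound[OF that]
      by (intro bounded_integrable[of _ "2 * b * b * b"]) (auto simp: abs_mult mult.assoc)
    note i2 = integrable_triple_product[OF that]
    have "expectation (\<lambda>\<omega>. \<bar>X k \<omega>\<bar> * (Z i \<omega> * Z j \<omega>)) \<le> expectation (\<lambda>\<omega>. \<bar>X k \<omega>\<bar> * \<bar>Z i \<omega>\<bar> * \<bar>Z j \<omega>\<bar>)"
      by (rule integral_mono[OF i1 i2])
         (auto simp: mult.assoc simp flip: abs_mult intro!: mult_left_mono)
    then show ?thesis using expectation_triple_product_le[OF that] i1 by linarith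
  qed
  have "expectation T = (\<Sum>i\<in>triples. expectation (\<lambda>\<omega>. case i of (k, i, j) \<Rightarrow> \<bar>X k \<omega>\<bar> * (Z i \<omega> * Z j \<omega>)))"
    unfolding T_def[abs_def]
    by (rule Bochner_Integration.integral_sum) (use 1 sub in \<open>auto simp: triples_def\<close>)
  also have "\<dots> \<le> (\<Sum>i\<in>triples. 2 / 3 * (case i of (k, i, j) \<Rightarrow> a k + a i + a j))"
    using 1 sub by (intro sum_mono) (auto simp: triples_def)
  also have "\<dots> = 2 / 3 * (\<Sum>(k, i, j)\<in>triples. a k + a i + a j)" by (simp add: sum_distrib_left)
  also have "\<dots> \<le> 2 / 3 * (3 * d\<^sup>2 * A)"
    by (intro mult_left_mono sum_triples_le assms) auto
  finally show ?thesis by (simp add: mult.commute)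
qed

text \<open>Blocks of three vertices; a vertex \<open>q\<close> lies in at most \<open>3 * d\<^sup>2\<close> triples \<open>(k, i, j)\<close>, namely
  \<open>d\<^sup>2\<close> for each of the three positions that \<open>q\<close> can take. In the square of
  \<open>X k * Z i * Z j\<close>, one copy is bounded by \<open>2 * b\<^sup>3\<close> and the other one is a third order product.\<close>

lemma variance_T_le:
  assumes "V \<noteq> {}"
  shows "variance T \<le> 36 * d ^ 5 * b ^ 3 * A"
proof -
  have d0: "d \<ge> 0" using assms d_nonneg by blast
  have b0: "b \<ge> 0" using assms b_nonneg by blast
  have sub: "k \<in> V \<Longrightarrow> i \<in> N k \<Longrightarrow> i \<in> V" for k i using N_sub by blast
  let ?U = "\<lambda>(k, i, j) \<omega>. \<bar>X k \<omega>\<bar> * (Z i \<omega> * Z j \<omega>)" and ?B = "\<lambda>(k, i, j). {k, i, j}"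
  have T: "T = (\<lambda>\<omega>. \<Sum>t\<in>triples. ?U t \<omega>)"
    unfolding T_def[abs_def] by (intro ext sum.cong) auto
  have "variance T \<le> 3 * d * (3 * d\<^sup>2) * (\<Sum>t\<in>triples. expectation (\<lambda>\<omega>. (?U t \<omega>)\<^sup>2))"
    unfolding T
  proof (rule variance_block_sum[where B = ?B and C = "2 * b * (b * b)"])
    fix t assume "t \<in> triples"
    then obtain k i j where t: "t = (k, i, j)" "k \<in> V" "i \<in> V" "j \<in> V"
      unfolding triples_def using sub by auto
    show "determined_by (?B t) (?U t)"
      using t determined_by_compose[OF determined_by_X, of k "{k, i, j}" abs]
      by (auto intro!: determined_by_mult determined_by_Z)
    show "?B t \<subseteq> V" using t by auto
    show "real (card (?B t)) \<le> 3" using t by (auto simp: card_insert_if)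
    show "\<bar>?U t \<omega>\<bar> \<le> 2 * b * (b * b)" for \<omega>
      using t X_bound[of k \<omega>] Z_bound[of i \<omega>] Z_bound[of j \<omega>] b0
      by (auto simp: abs_mult intro!: mult_mono)
  next
    fix q assume q: "q \<in> V"
    \<comment> \<open>The vertex \<open>q\<close> can be the centre of a triple, or one of the two neighbours; in the latter cases
      the centre is a neighbour of \<open>q\<close> and the third vertex is a neighbour of the centre.\<close>
    let ?f = "\<lambda>(k, i). (k, q, i)" and ?g = "\<lambda>(k, i). (k, i, q)"
    let ?S = "Sigma (N q) N"
    have fS: "finite ?S" using finite_N q sub by auto
    have "card ?S = (\<Sum>k\<in>N q. card (N k))"
      using finite_N q sub by (intro card_SigmaI) auto
    then have "real (card ?S) = (\<Sum>k\<in>N q. real (card (N k)))" by simp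
    also have "\<dots> \<le> (\<Sum>k\<in>N q. d)" using q sub by (intro sum_mono N_card) auto
    also have "\<dots> \<le> d * d" using N_card[OF q] d0 by (simp add: mult_right_mono)
    finally have S: "real (card ?S) \<le> d\<^sup>2" by (simp add: power2_eq_square)
    have "{t \<in> triples. q \<in> ?B t} \<subseteq> {q} \<times> (N q \<times> N q) \<union> (?f ` ?S \<union> ?g ` ?S)"
      unfolding triples_def using N_sym by (auto simp: image_iff)
    then have "card {t \<in> triples. q \<in> ?B t} \<le> card ({q} \<times> (N q \<times> N q) \<union> (?f ` ?S \<union> ?g ` ?S))"
      using finite_N[OF q] fS by (intro card_mono) auto
    also have "\<dots> \<le> card ({q} \<times> (N q \<times> N q)) + (card (?f ` ?S) + card (?g ` ?S))"
      by (intro order_trans[OF card_Un_le] add_mono card_Un_le order_refl)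
    also have "\<dots> \<le> card (N q) * card (N q) + (card ?S + card ?S)"
      using fS by (intro add_mono card_image_le) (auto simp: card_cartesian_product)
    finally have "real (card {t \<in> triples. q \<in> ?B t}) \<le> real (card (N q)) * real (card (N q)) + 2 * real (card ?S)"
      by (simp flip: of_nat_mult of_nat_add)
    also have "\<dots> \<le> d * d + 2 * d\<^sup>2"
      using N_card[OF q] d0 S by (intro add_mono mult_mono) auto
    finally show "real (card {t \<in> triples. q \<in> ?B t}) \<le> 3 * d\<^sup>2"
      by (simp add: power2_eq_square)
  qed (use finite_triples d0 in auto)
  also have "(\<Sum>t\<in>triples. expectation (\<lambda>\<omega>. (?U t \<omega>)\<^sup>2))
      \<le> (\<Sum>t\<in>triples. 4 / 3 * b ^ 3 * (case t of (k, i, j) \<Rightarrow> a k + a i + a j))"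
  proof (rule sum_mono)
    fix t assume "t \<in> triples"
    then obtain k i j where t: "t = (k, i, j)" "k \<in> V" "i \<in> V" "j \<in> V"
      unfolding triples_def using sub by auto
    have "integrable M (\<lambda>\<omega>. \<bar>X k \<omega>\<bar> * \<bar>Z i \<omega>\<bar> * \<bar>Z j \<omega>\<bar>)"
      by (rule integrable_triple_product[OF t(2-4)])
    then have "expectation (\<lambda>\<omega>. (\<bar>X k \<omega>\<bar> * (Z i \<omega> * Z j \<omega>))\<^sup>2)
        \<le> expectation (\<lambda>\<omega>. 2 * b ^ 3 * (\<bar>X k \<omega>\<bar> * \<bar>Z i \<omega>\<bar> * \<bar>Z j \<omega>\<bar>))"
    proof (intro integral_mono')
      fix \<omega>
      have "(\<bar>X k \<omega>\<bar> * (Z i \<omega> * Z j \<omega>))\<^sup>2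
          = (\<bar>X k \<omega>\<bar> * \<bar>Z i \<omega>\<bar> * \<bar>Z j \<omega>\<bar>) * (\<bar>X k \<omega>\<bar> * \<bar>Z i \<omega>\<bar> * \<bar>Z j \<omega>\<bar>)"
        by (simp add: power2_eq_square mult.assoc mult.left_commute)
      also have "\<dots> \<le> 2 * b * b * b * (\<bar>X k \<omega>\<bar> * \<bar>Z i \<omega>\<bar> * \<bar>Z j \<omega>\<bar>)"
        by (intro mult_right_mono triple_product_bound[OF t(2-4)]) auto
      finally show "(\<bar>X k \<omega>\<bar> * (Z i \<omega> * Z j \<omega>))\<^sup>2 \<le> 2 * b ^ 3 * (\<bar>X k \<omega>\<bar> * \<bar>Z i \<omega>\<bar> * \<bar>Z j \<omega>\<bar>)"
        by (simp add: power3_eq_cube mult.assoc)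
    qed (use b0 in auto)
    also have "\<dots> = 2 * b ^ 3 * expectation (\<lambda>\<omega>. \<bar>X k \<omega>\<bar> * \<bar>Z i \<omega>\<bar> * \<bar>Z j \<omega>\<bar>)" by simp
    also have "\<dots> \<le> 2 * b ^ 3 * (2 / 3 * (a k + a i + a j))"
      using t b0 by (intro mult_left_mono expectation_triple_product_le) auto
    finally show "expectation (\<lambda>\<omega>. (?U t \<omega>)\<^sup>2) \<le> 4 / 3 * b ^ 3 * (case t of (k, i, j) \<Rightarrow> a k + a i + a j)"
      by (simp add: t algebra_simps)
  qed
  also have "\<dots> = 4 / 3 * b ^ 3 * (\<Sum>(k, i, j)\<in>triples. a k + a i + a j)" by (simp add: sum_distrib_left)
  also have "\<dots> \<le> 4 / 3 * b ^ 3 * (3 * d\<^sup>2 * A)"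
    using b0 by (intro mult_left_mono sum_triples_le assms) auto
  finally have "variance T \<le> 3 * d * (3 * d\<^sup>2) * (4 / 3 * b ^ 3 * (3 * d\<^sup>2 * A))"
    using d0 by (simp add: mult_left_mono)
  also have "\<dots> = 36 * d ^ 5 * b ^ 3 * A"
    by (simp add: power2_eq_square power3_eq_cube eval_nat_numeral)
  finally show ?thesis .
qed

end

section \<open>Stein's method with dependency neighbourhoods\<close>

locale normalized_dependency = bounded_dependency +
  assumes unit_variance: "expectation (\<lambda>\<omega>. (\<Sum>k\<in>V. X k \<omega>)\<^sup>2) = 1"
begin

lemma V_nonempty: "V \<noteq> {}"
  using unit_variance by (cases "V = {}") auto

lemma b_ge_0: "0 \<le> b" and d_ge_0: "0 \<le> d"
  using V_nonempty b_nonneg d_nonneg by blast+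

definition W where "W \<omega> = (\<Sum>k\<in>V. X k \<omega>)"
definition H where "H k \<omega> = (\<Sum>j\<in>N k. Z j \<omega>)"

lemma W_measurable [measurable]: "W \<in> borel_measurable M"
  unfolding W_def[abs_def] using X_measurable by measurable

lemma H_measurable: "k \<in> V \<Longrightarrow> H k \<in> borel_measurable M"
  unfolding H_def[abs_def] using Z_measurable N_sub by (intro borel_measurable_sum) blast

lemma W_bound: "\<bar>W \<omega>\<bar> \<le> real (card V) * (2 * b)"
proof -
  have "\<bar>W \<omega>\<bar> \<le> (\<Sum>k\<in>V. \<bar>X k \<omega>\<bar>)" unfolding W_def by (rule sum_abs)
  also have "\<dots> \<le> (\<Sum>k\<in>V. 2 * b)" by (intro sum_mono X_bound)
  finally show ?thesis by simp
qed

lemma H_bound: assumes "k \<in> V" shows "\<bar>H k \<omega>\<bar> \<le> d * b"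
proof -
  have "\<bar>H k \<omega>\<bar> \<le> (\<Sum>j\<in>N k. \<bar>Z j \<omega>\<bar>)" unfolding H_def by (rule sum_abs)
  also have "\<dots> \<le> (\<Sum>j\<in>N k. b)" using N_sub[OF assms] by (intro sum_mono Z_bound) blast
  also have "\<dots> \<le> d * b" using N_card[OF assms] b_ge_0 by (simp add: mult_right_mono)
  finally show ?thesis .
qed

lemma Q_eq: "Q \<omega> = (\<Sum>k\<in>V. X k \<omega> * H k \<omega>)"
proof -
  have "(\<Sum>k\<in>V. X k \<omega> * H k \<omega>) = (\<Sum>k\<in>V. \<Sum>j\<in>N k. X k \<omega> * Z j \<omega>)"
    by (simp add: H_def sum_distrib_left)
  also have "\<dots> = Q \<omega>"
    unfolding Q_def pairs_def using finite_V finite_N by (subst sum.Sigma) auto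
  finally show ?thesis ..
qed

lemma T_eq: "T \<omega> = (\<Sum>k\<in>V. \<bar>X k \<omega>\<bar> * (H k \<omega>)\<^sup>2)"
proof -
  have "(H k \<omega>)\<^sup>2 = (\<Sum>i\<in>N k. \<Sum>j\<in>N k. Z i \<omega> * Z j \<omega>)" for k
    by (simp add: H_def power2_eq_square sum_product)
  then have "(\<Sum>k\<in>V. \<bar>X k \<omega>\<bar> * (H k \<omega>)\<^sup>2) = (\<Sum>k\<in>V. \<Sum>i\<in>N k. \<Sum>j\<in>N k. \<bar>X k \<omega>\<bar> * (Z i \<omega> * Z j \<omega>))"
    by (simp add: sum_distrib_left)
  also have "\<dots> = (\<Sum>k\<in>V. \<Sum>(i, j)\<in>N k \<times> N k. \<bar>X k \<omega>\<bar> * (Z i \<omega> * Z j \<omega>))"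
    by (simp add: sum.cartesian_product)
  also have "\<dots> = T \<omega>"
    unfolding T_def triples_def using finite_V finite_N by (subst sum.Sigma) auto
  finally show ?thesis ..
qed

lemma Q_measurable [measurable]: "Q \<in> borel_measurable M"
  unfolding Q_eq[abs_def] using X_measurable H_measurable by measurable

lemma T_measurable [measurable]: "T \<in> borel_measurable M"
  unfolding T_eq[abs_def] using X_measurable H_measurable by measurable

lemma Q_bound: "\<bar>Q \<omega>\<bar> \<le> real (card V) * (2 * b * (d * b))"
proof -
  have "\<bar>Q \<omega>\<bar> \<le> (\<Sum>k\<in>V. \<bar>X k \<omega> * H k \<omega>\<bar>)" unfolding Q_eq by (rule sum_abs)
  also have "\<dots> \<le> (\<Sum>k\<in>V. 2 * b * (d * b))"
    unfolding abs_mult using b_ge_0 by (intro sum_mono mult_mono X_bound H_bound) auto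
  finally show ?thesis by simp
qed

lemma T_bound: "\<bar>T \<omega>\<bar> \<le> real (card V) * (2 * b * (d * b)\<^sup>2)"
proof -
  have "\<bar>T \<omega>\<bar> \<le> (\<Sum>k\<in>V. \<bar>\<bar>X k \<omega>\<bar> * (H k \<omega>)\<^sup>2\<bar>)" unfolding T_eq by (rule sum_abs)
  also have "\<dots> \<le> (\<Sum>k\<in>V. 2 * b * (d * b)\<^sup>2)"
  proof (rule sum_mono)
    fix k assume k: "k \<in> V"
    have "(H k \<omega>)\<^sup>2 \<le> (d * b)\<^sup>2"
      using power_mono[OF H_bound[OF k, of \<omega>], of 2] by simp
    then show "\<bar>\<bar>X k \<omega>\<bar> * (H k \<omega>)\<^sup>2\<bar> \<le> 2 * b * (d * b)\<^sup>2"
      using X_bound[OF k, of \<omega>] b_ge_0 by (auto simp: abs_mult intro!: mult_mono)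
  qed
  finally show ?thesis by simp
qed

lemma T_nonneg: "0 \<le> T \<omega>"
  unfolding T_eq by (intro sum_nonneg) auto

text \<open>Removing the neighbourhood of \<open>k\<close> from \<open>W\<close> with the uncentred variables leaves a function of the
  far vertices shifted by a constant, hence a variable independent of \<open>X k\<close>.\<close>

lemma determined_by_W_minus_H:
  assumes "k \<in> V" shows "determined_by (V - N k) (\<lambda>\<omega>. W \<omega> - H k \<omega>)"
proof -
  let ?c = "\<Sum>k\<in>V. expectation (Z k)"
  have "W \<omega> - H k \<omega> = (\<Sum>j\<in>V - N k. Z j \<omega>) - ?c" for \<omega>
    using finite_V N_sub[OF assms]
    by (simp add: W_def H_def X_def sum_subtractf sum_diff)
  moreover have "determined_by (V - N k) (\<lambda>\<omega>. (\<Sum>j\<in>V - N k. Z j \<omega>) - ?c)"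
    by (rule determined_by_compose[OF determined_by_sum_Z, of _ _ "\<lambda>x. x - ?c"]) auto
  ultimately show ?thesis by simp
qed

lemma expectation_X_mult_W_minus_H:
  assumes "k \<in> V" and g: "g \<in> borel_measurable borel" "integrable M (\<lambda>\<omega>. g (W \<omega> - H k \<omega>))"
  shows "expectation (\<lambda>\<omega>. X k \<omega> * g (W \<omega> - H k \<omega>)) = 0"
proof -
  have "expectation (\<lambda>\<omega>. X k \<omega> * g (W \<omega> - H k \<omega>))
      = expectation (X k) * expectation (\<lambda>\<omega>. g (W \<omega> - H k \<omega>))"
  proof (rule expectation_mult_separated)
    show "determined_by {k} (X k)" by (rule determined_by_X) simp
    show "determined_by (V - N k) (\<lambda>\<omega>. g (W \<omega> - H k \<omega>))"
      by (rule determined_by_compose[OF determined_by_W_minus_H[OF assms(1)] g(1)])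
    show "integrable M (X k)"
      using bounded_integrable[OF X_measurable X_bound] assms(1) by blast
  qed (use assms in auto)
  then show ?thesis using expectation_X[OF assms(1)] by simp
qed

lemma integrable_mult_bounded:
  fixes U G :: "'a \<Rightarrow> real"
  assumes "U \<in> borel_measurable M" "G \<in> borel_measurable M"
    and "\<And>\<omega>. \<bar>U \<omega>\<bar> \<le> C" "\<And>\<omega>. \<bar>G \<omega>\<bar> \<le> C'"
  shows "integrable M (\<lambda>\<omega>. U \<omega> * G \<omega>)"
proof (rule bounded_integrable)
  show "\<bar>U \<omega> * G \<omega>\<bar> \<le> C * C'" for \<omega>
    unfolding abs_mult using assms(3,4) by (meson abs_ge_zero mult_mono order_trans)
qed (use assms in measurable)

text \<open>The variance \<open>1\<close> is the sum of the expectations of \<open>X k * W\<close>, and the part \<open>W - H k\<close> of the last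
  factor does not contribute.\<close>

lemma expectation_Q: "expectation Q = 1"
proof -
  let ?D = "\<lambda>k \<omega>. W \<omega> - H k \<omega>"
  have D: "?D k \<in> borel_measurable M" "\<bar>?D k \<omega>\<bar> \<le> real (card V) * (2 * b) + d * b"
    if "k \<in> V" for k \<omega>
    using H_measurable[OF that] W_bound[of \<omega>] H_bound[OF that, of \<omega>] by (measurable, linarith)
  have iD: "integrable M (?D k)" if "k \<in> V" for k
    using bounded_integrable[OF D[OF that]] .
  have iXD: "integrable M (\<lambda>\<omega>. X k \<omega> * ?D k \<omega>)" if "k \<in> V" for k
    by (rule integrable_mult_bounded[OF X_measurable D(1) X_bound D(2)]) (fact that)+
  have iXH: "integrable M (\<lambda>\<omega>. X k \<omega> * H k \<omega>)" if "k \<in> V" for k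
    by (rule integrable_mult_bounded[OF X_measurable H_measurable X_bound H_bound]) (fact that)+
  have "(W \<omega>)\<^sup>2 = Q \<omega> + (\<Sum>k\<in>V. X k \<omega> * ?D k \<omega>)" for \<omega>
  proof -
    have "(W \<omega>)\<^sup>2 = (\<Sum>k\<in>V. X k \<omega> * W \<omega>)"
      by (simp add: power2_eq_square W_def sum_distrib_right)
    also have "\<dots> = (\<Sum>k\<in>V. X k \<omega> * H k \<omega> + X k \<omega> * ?D k \<omega>)"
      by (simp add: algebra_simps)
    finally show ?thesis by (simp add: Q_eq sum.distrib)
  qed
  then have "1 = expectation (\<lambda>\<omega>. Q \<omega> + (\<Sum>k\<in>V. X k \<omega> * ?D k \<omega>))"
    using unit_variance by (simp add: W_def)
  also have "\<dots> = expectation Q + expectation (\<lambda>\<omega>. \<Sum>k\<in>V. X k \<omega> * ?D k \<omega>)"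
    using iXD bounded_integrable[OF Q_measurable Q_bound]
    by (intro Bochner_Integration.integral_add Bochner_Integration.integrable_sum) auto
  also have "expectation (\<lambda>\<omega>. \<Sum>k\<in>V. X k \<omega> * ?D k \<omega>) = (\<Sum>k\<in>V. expectation (\<lambda>\<omega>. X k \<omega> * ?D k \<omega>))"
    by (intro Bochner_Integration.integral_sum iXD)
  also have "\<dots> = 0"
    using expectation_X_mult_W_minus_H[of _ "\<lambda>x. x"] iD by (intro sum.neutral) auto
  finally show ?thesis by simp
qed

text \<open>The variable \<open>T\<close> concentrates around its mean, so up to its standard deviation it may be replaced
  by its mean in expectations. This decouples \<open>T\<close> from \<open>\<bar>W\<bar>\<close> and from the event that \<open>W\<close> falls into the
  window of the ramp.\<close>

lemma expectation_T_mult_le: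
  fixes G :: "'a \<Rightarrow> real"
  assumes "G \<in> borel_measurable M" "\<And>\<omega>. \<bar>G \<omega>\<bar> \<le> C" "expectation (\<lambda>\<omega>. (G \<omega>)\<^sup>2) \<le> 1"
    and "variance T \<le> \<sigma>\<^sup>2" "\<sigma> > 0"
  shows "expectation (\<lambda>\<omega>. T \<omega> * G \<omega>) \<le> expectation T * expectation G + \<sigma>"
proof -
  have iT: "integrable M T" by (rule bounded_integrable[OF T_measurable T_bound])
  have iG: "integrable M G" by (rule bounded_integrable[OF assms(1,2)])
  have iTG: "integrable M (\<lambda>\<omega>. T \<omega> * G \<omega>)"
    by (rule integrable_mult_bounded[OF T_measurable assms(1) T_bound assms(2)])
  have iG2: "integrable M (\<lambda>\<omega>. (G \<omega>)\<^sup>2)"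
    using integrable_mult_bounded[OF assms(1) assms(1) assms(2) assms(2)] by (simp add: power2_eq_square)
  let ?T = "\<lambda>\<omega>. T \<omega> - expectation T"
  have T': "?T \<in> borel_measurable M" "\<bar>?T \<omega>\<bar> \<le> real (card V) * (2 * b * (d * b)\<^sup>2) + \<bar>expectation T\<bar>" for \<omega>
    using T_bound[of \<omega>] by (measurable, linarith)
  have iT2: "integrable M (\<lambda>\<omega>. (?T \<omega>)\<^sup>2)"
    using integrable_mult_bounded[OF T'(1) T'(1) T'(2) T'(2)] by (simp add: power2_eq_square)
  have "expectation (\<lambda>\<omega>. T \<omega> * G \<omega>) = expectation (\<lambda>\<omega>. ?T \<omega> * G \<omega> + expectation T * G \<omega>)"
    by (simp add: algebra_simps)
  also have "\<dots> = expectation (\<lambda>\<omega>. ?T \<omega> * G \<omega>) + expectation T * expectation G"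
    using iG iTG by (simp add: left_diff_distrib)
  also have "expectation (\<lambda>\<omega>. ?T \<omega> * G \<omega>) \<le> \<sigma>"
    using expectation_mult_le[OF T'(1) assms(1) iT2 iG2 assms(4,3,5)] by linarith
  finally show ?thesis by linarith
qed

lemma expectation_abs_W_le: "expectation (\<lambda>\<omega>. \<bar>W \<omega>\<bar>) \<le> 1"
proof -
  have i: "integrable M (\<lambda>\<omega>. W \<omega> * W \<omega>)"
    by (rule integrable_mult_bounded[OF W_measurable W_measurable W_bound W_bound])
  have W2: "expectation (\<lambda>\<omega>. (W \<omega>)\<^sup>2) = 1" using unit_variance by (simp add: W_def)
  have "expectation (\<lambda>\<omega>. \<bar>W \<omega>\<bar>) \<le> expectation (\<lambda>\<omega>. ((W \<omega>)\<^sup>2 + 1) / 2)"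
  proof (rule integral_mono')
    show "integrable M (\<lambda>\<omega>. ((W \<omega>)\<^sup>2 + 1) / 2)" using i by (simp add: power2_eq_square)
    show "\<bar>W \<omega>\<bar> \<le> ((W \<omega>)\<^sup>2 + 1) / 2" for \<omega>
      using sum_squares_bound[of "\<bar>W \<omega>\<bar>" 1] by simp
  qed simp
  also have "\<dots> = 1" using i prob_space W2 by (simp add: power2_eq_square)
  finally show ?thesis .
qed

text \<open>Apply the equation for the Stein solution \<open>f\<close> of the ramp at \<open>W\<close>. In the expectation of \<open>W * f W\<close>,
  \<open>f W\<close> may be replaced by \<open>f W - f (W - H k)\<close> in the \<open>k\<close>-th summand, and this difference by
  \<open>H k * f' W\<close>. The linear terms add up to \<open>Q * f' W\<close>, to be compared with \<open>f' W\<close>; as \<open>Q\<close> has mean \<open>1\<close>,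
  this costs twice its standard deviation. The Taylor remainders add up to at most
  \<open>T * (2 * \<bar>W\<bar> + 3 + indicator I W / e)\<close>, and \<open>T\<close> is decoupled from the other factor.\<close>

lemma stein_bound:
  fixes z e :: real
  defines "I \<equiv> {z - d * b..z + e + d * b}"
  assumes e: "e > 0" and vQ: "variance Q \<le> \<sigma>\<^sup>2" "\<sigma> > 0" and vT: "variance T \<le> \<tau>\<^sup>2" "\<tau> > 0"
  shows "\<bar>expectation (\<lambda>\<omega>. ramp z e (W \<omega>)) - ramp_mean z e\<bar>
    \<le> 2 * \<sigma> + (5 * expectation T + 2 * \<tau>) + (expectation T * prob {\<omega> \<in> space M. W \<omega> \<in> I} + \<tau>) / e"
proof -
  obtain f f' where df: "\<And>w. (f has_real_derivative f' w) (at w)"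
    and f': "\<And>w. f' w = w * f w + (ramp z e w - ramp_mean z e)"
    and f3: "\<And>w. \<bar>f w\<bar> \<le> 3" and f2: "\<And>w. \<bar>f' w\<bar> \<le> 2"
    and exp: "\<And>w t \<delta>. \<bar>t\<bar> \<le> \<delta> \<Longrightarrow> \<bar>t * f' w - (f w - f (w - t))\<bar>
           \<le> t\<^sup>2 * (2 * \<bar>w\<bar> + 3 + indicator {z - \<delta>..z + e + \<delta>} w / e)"
    using stein_solution_ramp[OF e, of z thesis] by blast
  have f_meas [measurable]: "f \<in> borel_measurable borel"
    using df by (intro borel_measurable_continuous_onI continuous_at_imp_continuous_on ballI) (rule DERIV_isCont)
  have f'_meas [measurable]: "f' \<in> borel_measurable borel"
    unfolding f'[abs_def] by measurable
  let ?J = "\<lambda>\<omega>. indicator I (W \<omega>) :: real"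
  have [measurable]: "I \<in> sets borel" unfolding I_def by simp
  let ?R = "\<lambda>k \<omega>. H k \<omega> * f' (W \<omega>) - (f (W \<omega>) - f (W \<omega> - H k \<omega>))"
  let ?L = "\<lambda>k \<omega>. f (W \<omega> - H k \<omega>)"
  \<comment> \<open>Add and subtract \<open>f' W * Q\<close> and, in each summand, \<open>X k * f (W - H k)\<close>.\<close>
  have decomp: "ramp z e (W \<omega>) - ramp_mean z e
      = f' (W \<omega>) * (1 - Q \<omega>) + (\<Sum>k\<in>V. X k \<omega> * ?R k \<omega>) - (\<Sum>k\<in>V. X k \<omega> * ?L k \<omega>)" for \<omega>
  proof -
    have "ramp z e (W \<omega>) - ramp_mean z e = f' (W \<omega>) - (\<Sum>k\<in>V. X k \<omega>) * f (W \<omega>)"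
      using f'[of "W \<omega>"] by (simp add: W_def)
    also have "\<dots> = f' (W \<omega>) * (1 - Q \<omega>) + (f' (W \<omega>) * Q \<omega> - (\<Sum>k\<in>V. X k \<omega> * f (W \<omega>)))"
      unfolding sum_distrib_right[symmetric] by (simp add: algebra_simps)
    also have "f' (W \<omega>) * Q \<omega> = (\<Sum>k\<in>V. f' (W \<omega>) * (X k \<omega> * H k \<omega>))"
      by (simp add: Q_eq sum_distrib_left)
    also have "\<dots> - (\<Sum>k\<in>V. X k \<omega> * f (W \<omega>)) = (\<Sum>k\<in>V. X k \<omega> * ?R k \<omega> - X k \<omega> * ?L k \<omega>)"
      unfolding sum_subtractf[symmetric] by (intro sum.cong) (auto simp: algebra_simps)
    finally show ?thesis by (simp add: sum_subtractf)
  qed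
  have L: "integrable M (?L k)" "integrable M (\<lambda>\<omega>. X k \<omega> * ?L k \<omega>)" if "k \<in> V" for k
  proof -
    note H_measurable[OF that, measurable] X_measurable[OF that, measurable]
    have m: "?L k \<in> borel_measurable M" by measurable
    show "integrable M (?L k)" by (rule bounded_integrable[OF m f3])
    show "integrable M (\<lambda>\<omega>. X k \<omega> * ?L k \<omega>)"
      by (rule integrable_mult_bounded[OF X_measurable m X_bound f3]) (fact that)+
  qed
  have R: "integrable M (\<lambda>\<omega>. X k \<omega> * ?R k \<omega>)" if "k \<in> V" for k
  proof (rule integrable_mult_bounded[OF X_measurable _ X_bound])
    note H_measurable[OF that, measurable]
    show "?R k \<in> borel_measurable M" by measurable
    show "\<bar>?R k \<omega>\<bar> \<le> d * b * 2 + (3 + 3)" for \<omega>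
    proof -
      have "\<bar>H k \<omega> * f' (W \<omega>)\<bar> \<le> d * b * 2"
        unfolding abs_mult using H_bound[OF that] f2 d_ge_0 b_ge_0 by (intro mult_mono) auto
      then show ?thesis using f3[of "W \<omega>"] f3[of "W \<omega> - H k \<omega>"] by linarith
    qed
  qed (fact that)+
  have Q1: "\<bar>1 - Q \<omega>\<bar> \<le> 1 + real (card V) * (2 * b * (d * b))" for \<omega>
    using Q_bound[of \<omega>] by linarith
  have iQ: "integrable M (\<lambda>\<omega>. f' (W \<omega>) * (1 - Q \<omega>))"
    by (rule integrable_mult_bounded[OF _ _ f2 Q1]) measurable
  have "expectation (\<lambda>\<omega>. ramp z e (W \<omega>)) - ramp_mean z e = expectation (\<lambda>\<omega>. ramp z e (W \<omega>) - ramp_mean z e)"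
  proof -
    have "integrable M (\<lambda>\<omega>. ramp z e (W \<omega>))"
      by (rule bounded_integrable[of _ 1]) (use ramp_bounds in \<open>auto simp: abs_le_iff intro: order_trans[of _ 0]\<close>)
    then show ?thesis using prob_space by simp
  qed
  also have "\<dots> = expectation (\<lambda>\<omega>. f' (W \<omega>) * (1 - Q \<omega>)) + expectation (\<lambda>\<omega>. \<Sum>k\<in>V. X k \<omega> * ?R k \<omega>)
      - expectation (\<lambda>\<omega>. \<Sum>k\<in>V. X k \<omega> * ?L k \<omega>)"
    unfolding decomp using iQ R L(2) by simp
  also have "expectation (\<lambda>\<omega>. \<Sum>k\<in>V. X k \<omega> * ?L k \<omega>) = (\<Sum>k\<in>V. expectation (\<lambda>\<omega>. X k \<omega> * ?L k \<omega>))"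
    by (intro Bochner_Integration.integral_sum L)
  also have "\<dots> = 0"
    using expectation_X_mult_W_minus_H[OF _ f_meas L(1)] by (intro sum.neutral) auto
  finally have main: "expectation (\<lambda>\<omega>. ramp z e (W \<omega>)) - ramp_mean z e
    = expectation (\<lambda>\<omega>. f' (W \<omega>) * (1 - Q \<omega>)) + expectation (\<lambda>\<omega>. \<Sum>k\<in>V. X k \<omega> * ?R k \<omega>)" by simp
  have part1: "\<bar>expectation (\<lambda>\<omega>. f' (W \<omega>) * (1 - Q \<omega>))\<bar> \<le> 2 * \<sigma>"
  proof -
    let ?G = "\<lambda>\<omega>. f' (W \<omega>) / 2" and ?U = "\<lambda>\<omega>. 1 - Q \<omega>"
    have G1: "\<bar>?G \<omega>\<bar> \<le> 1" for \<omega> using f2[of "W \<omega>"] by simp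
    have mG: "?G \<in> borel_measurable M" and mU: "?U \<in> borel_measurable M" by measurable
    have iU2: "integrable M (\<lambda>\<omega>. (?U \<omega>)\<^sup>2)" and iG2: "integrable M (\<lambda>\<omega>. (?G \<omega>)\<^sup>2)"
      using integrable_mult_bounded[OF mU mU Q1 Q1] integrable_mult_bounded[OF mG mG G1 G1]
      by (simp_all add: power2_eq_square)
    have "expectation (\<lambda>\<omega>. (?G \<omega>)\<^sup>2) \<le> expectation (\<lambda>\<omega>. 1)"
    proof (rule integral_mono[OF iG2])
      show "(?G \<omega>)\<^sup>2 \<le> 1" for \<omega> using G1[of \<omega>] by (simp add: abs_square_le_1)
    qed simp
    then have "expectation (\<lambda>\<omega>. (?G \<omega>)\<^sup>2) \<le> 1" using prob_space by simp
    moreover have "expectation (\<lambda>\<omega>. (?U \<omega>)\<^sup>2) \<le> \<sigma>\<^sup>2"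
      using vQ(1) unfolding expectation_Q by (simp add: power2_commute)
    ultimately have "\<bar>expectation (\<lambda>\<omega>. ?U \<omega> * ?G \<omega>)\<bar> \<le> \<sigma>"
      by (intro expectation_mult_le mU mG iU2 iG2 vQ(2))
    moreover have "expectation (\<lambda>\<omega>. f' (W \<omega>) * (1 - Q \<omega>)) = 2 * expectation (\<lambda>\<omega>. ?U \<omega> * ?G \<omega>)"
      by (subst integral_mult_right_zero[symmetric]) (auto intro!: Bochner_Integration.integral_cong)
    ultimately show ?thesis by (simp add: abs_mult)
  qed
  have part2: "\<bar>expectation (\<lambda>\<omega>. \<Sum>k\<in>V. X k \<omega> * ?R k \<omega>)\<bar>
    \<le> (5 * expectation T + 2 * \<tau>) + (expectation T * prob {\<omega> \<in> space M. W \<omega> \<in> I} + \<tau>) / e"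
  proof -
    have aW: "(\<lambda>\<omega>. \<bar>W \<omega>\<bar>) \<in> borel_measurable M" "\<bar>\<bar>W \<omega>\<bar>\<bar> \<le> real (card V) * (2 * b)" for \<omega>
      using W_bound by auto
    have J: "?J \<in> borel_measurable M" "\<bar>?J \<omega>\<bar> \<le> 1" for \<omega> by auto
    have iT: "integrable M T" by (rule bounded_integrable[OF T_measurable T_bound])
    have iTW: "integrable M (\<lambda>\<omega>. T \<omega> * \<bar>W \<omega>\<bar>)"
      by (rule integrable_mult_bounded[OF T_measurable aW(1) T_bound aW(2)])
    have iTJ: "integrable M (\<lambda>\<omega>. T \<omega> * ?J \<omega>)"
      by (rule integrable_mult_bounded[OF T_measurable J(1) T_bound J(2)])
    have EJ: "expectation ?J = prob {\<omega> \<in> space M. W \<omega> \<in> I}"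
    proof -
      have "expectation ?J = expectation (indicator {\<omega> \<in> space M. W \<omega> \<in> I})"
        by (intro Bochner_Integration.integral_cong) (auto simp: indicator_def)
      then show ?thesis by simp
    qed
    have TW: "expectation (\<lambda>\<omega>. T \<omega> * \<bar>W \<omega>\<bar>) \<le> expectation T + \<tau>"
    proof -
      have "expectation (\<lambda>\<omega>. T \<omega> * \<bar>W \<omega>\<bar>) \<le> expectation T * expectation (\<lambda>\<omega>. \<bar>W \<omega>\<bar>) + \<tau>"
        using unit_variance by (intro expectation_T_mult_le[OF aW _ vT]) (simp add: W_def)
      also have "\<dots> \<le> expectation T * 1 + \<tau>"
        using T_nonneg expectation_abs_W_le by (intro add_mono mult_left_mono) auto
      finally show ?thesis by simp
    qed
    have TJ: "expectation (\<lambda>\<omega>. T \<omega> * ?J \<omega>) \<le> expectation T * prob {\<omega> \<in> space M. W \<omega> \<in> I} + \<tau>"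
    proof -
      have "expectation (\<lambda>\<omega>. (?J \<omega>)\<^sup>2) = prob {\<omega> \<in> space M. W \<omega> \<in> I}"
        unfolding EJ[symmetric] by (intro Bochner_Integration.integral_cong) (auto simp: indicator_def)
      then show ?thesis
        using expectation_T_mult_le[OF J _ vT] unfolding EJ by simp
    qed
    have "\<bar>expectation (\<lambda>\<omega>. \<Sum>k\<in>V. X k \<omega> * ?R k \<omega>)\<bar> \<le> expectation (\<lambda>\<omega>. \<bar>\<Sum>k\<in>V. X k \<omega> * ?R k \<omega>\<bar>)"
      by (rule integral_abs_bound)
    also have "\<dots> \<le> expectation (\<lambda>\<omega>. 2 * (T \<omega> * \<bar>W \<omega>\<bar>) + 3 * T \<omega> + T \<omega> * ?J \<omega> / e)"
    proof (rule integral_mono')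
      show "integrable M (\<lambda>\<omega>. 2 * (T \<omega> * \<bar>W \<omega>\<bar>) + 3 * T \<omega> + T \<omega> * ?J \<omega> / e)"
        using iT iTW iTJ by simp
      fix \<omega>
      let ?w = "2 * \<bar>W \<omega>\<bar> + 3 + ?J \<omega> / e"
      have "\<bar>\<Sum>k\<in>V. X k \<omega> * ?R k \<omega>\<bar> \<le> (\<Sum>k\<in>V. \<bar>X k \<omega>\<bar> * \<bar>?R k \<omega>\<bar>)"
        unfolding abs_mult[symmetric] by (rule sum_abs)
      also have "\<dots> \<le> (\<Sum>k\<in>V. \<bar>X k \<omega>\<bar> * ((H k \<omega>)\<^sup>2 * ?w))"
        unfolding I_def by (intro sum_mono mult_left_mono exp H_bound) auto
      also have "\<dots> = T \<omega> * ?w" by (simp add: T_eq sum_distrib_right mult.assoc)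
      finally show "\<bar>\<Sum>k\<in>V. X k \<omega> * ?R k \<omega>\<bar> \<le> 2 * (T \<omega> * \<bar>W \<omega>\<bar>) + 3 * T \<omega> + T \<omega> * ?J \<omega> / e"
        by (simp add: algebra_simps)
      show "0 \<le> 2 * (T \<omega> * \<bar>W \<omega>\<bar>) + 3 * T \<omega> + T \<omega> * ?J \<omega> / e"
        using T_nonneg[of \<omega>] e by simp
    qed
    also have "\<dots> = 2 * expectation (\<lambda>\<omega>. T \<omega> * \<bar>W \<omega>\<bar>) + 3 * expectation T + expectation (\<lambda>\<omega>. T \<omega> * ?J \<omega>) / e"
      using iT iTW iTJ by simp
    also have "\<dots> \<le> 2 * (expectation T + \<tau>) + 3 * expectation T
        + (expectation T * prob {\<omega> \<in> space M. W \<omega> \<in> I} + \<tau>) / e"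
      using TW TJ e by (intro add_mono mult_left_mono divide_right_mono) auto
    finally show ?thesis by (simp add: algebra_simps)
  qed
  show ?thesis unfolding main using part1 part2 by linarith
qed

end

section \<open>Kolmogorov distance\<close>

lemma kolmogorov_distance_upper:
  assumes "real_distribution \<mu>" "real_distribution \<nu>"
  shows "\<bar>cdf \<mu> t - cdf \<nu> t\<bar> \<le> kolmogorov_distance \<mu> \<nu>"
proof -
  interpret \<mu>: real_distribution \<mu> by fact
  interpret \<nu>: real_distribution \<nu> by fact
  have "\<bar>cdf \<mu> s - cdf \<nu> s\<bar> \<le> 1" for s
    using \<mu>.cdf_nonneg[of s] \<mu>.cdf_bounded_prob[of s] \<nu>.cdf_nonneg[of s] \<nu>.cdf_bounded_prob[of s]
    by linarith
  then show ?thesis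
    unfolding kolmogorov_distance_def by (intro cSUP_upper bdd_aboveI2[of _ _ 1]) auto
qed

lemma kolmogorov_distance_le:
  "(\<And>t. \<bar>cdf \<mu> t - cdf \<nu> t\<bar> \<le> B) \<Longrightarrow> kolmogorov_distance \<mu> \<nu> \<le> B"
  unfolding kolmogorov_distance_def by (intro cSUP_least) auto

context normalized_dependency begin

abbreviation law where "law \<equiv> distr M borel W"

lemma real_distribution_law: "real_distribution law"
  by (rule real_distribution_distr) measurable

lemma cdf_law: "cdf law t = expectation (\<lambda>\<omega>. indicator {..t} (W \<omega>))"
proof -
  have "cdf law t = prob (W -` {..t} \<inter> space M)" by (simp add: cdf_def measure_distr)
  also have "\<dots> = expectation (indicator (W -` {..t} \<inter> space M))" by simp
  also have "\<dots> = expectation (\<lambda>\<omega>. indicator {..t} (W \<omega>))"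
    by (intro Bochner_Integration.integral_cong) (auto simp: indicator_def)
  finally show ?thesis .
qed

lemma expectation_ramp_bounds:
  assumes "e > 0"
  shows "cdf law z \<le> expectation (\<lambda>\<omega>. ramp z e (W \<omega>))"
    and "expectation (\<lambda>\<omega>. ramp z e (W \<omega>)) \<le> cdf law (z + e)"
proof -
  have i: "integrable M (\<lambda>\<omega>. indicator {..t} (W \<omega>) :: real)" for t
    by (rule bounded_integrable[of _ 1]) auto
  have r: "integrable M (\<lambda>\<omega>. ramp z e (W \<omega>))"
    by (rule bounded_integrable[of _ 1]) (use ramp_bounds in \<open>auto simp: abs_le_iff intro: order_trans[of _ 0]\<close>)
  show "cdf law z \<le> expectation (\<lambda>\<omega>. ramp z e (W \<omega>))"
    unfolding cdf_law by (rule integral_mono[OF i r indicator_le_ramp[OF assms]])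
  show "expectation (\<lambda>\<omega>. ramp z e (W \<omega>)) \<le> cdf law (z + e)"
    unfolding cdf_law by (rule integral_mono[OF r i ramp_le_indicator[OF assms]])
qed

text \<open>An interval is only as likely as under the normal law, up to twice the Kolmogorov distance. The
  distribution functions see half-open intervals, so the left end is moved by an arbitrary \<open>s > 0\<close>.\<close>

lemma concentration:
  assumes "l \<le> u"
  shows "prob {\<omega> \<in> space M. W \<omega> \<in> {l..u}} \<le> (u - l) / 2 + 2 * kolmogorov_distance law std_normal_distribution"
proof (rule field_le_epsilon)
  fix s :: real assume s: "s > 0"
  interpret law: real_distribution law by (rule real_distribution_law)
  let ?K = "kolmogorov_distance law std_normal_distribution"
  have K: "\<bar>cdf law t - std_normal_cdf t\<bar> \<le> ?K" for t
    by (rule kolmogorov_distance_upper[OF real_distribution_law real_dist_normal_dist])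
  have "prob {\<omega> \<in> space M. W \<omega> \<in> {l..u}} \<le> measure law {l - s<..u}"
    using s by (subst measure_distr) (auto intro!: finite_measure_mono)
  also have "\<dots> = cdf law u - cdf law (l - s)"
    using assms s by (intro law.cdf_diff_eq[symmetric]) auto
  also have "\<dots> \<le> (std_normal_cdf u - std_normal_cdf (l - s)) + 2 * ?K"
    using K[of u] K[of "l - s"] by linarith
  also have "\<dots> \<le> (u - (l - s)) / 2 + 2 * ?K"
    using std_normal_cdf_diff_le[of "u - (l - s)" "l - s"] assms s by simp
  finally show "prob {\<omega> \<in> space M. W \<omega> \<in> {l..u}} \<le> (u - l) / 2 + 2 * ?K + s"
    using s by (simp add: field_simps)
qed

text \<open>Stein's bound contains the probability of the window of the ramp, which is itself estimated by the
  distance \<open>K\<close> to be bounded. The ramp has width \<open>e = 0.3 * m\<close>, proportional to the target \<open>m\<close>, so the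
  coefficient of \<open>K\<close> on the right is a constant below \<open>0.2\<close> and can be absorbed on the left. All other
  terms are at most multiples of \<open>m\<close>; the assumption \<open>m < 1\<close> serves to bound \<open>m\<^sup>2\<close> by \<open>m\<close>.\<close>

lemma kolmogorov_distance_law_le:
  fixes m :: real
  assumes m: "0 < m" "m < 1" and \<eta>: "68.5 * (d\<^sup>2 * A) \<le> m" and \<delta>: "22.88 * (d * b) \<le> m"
  shows "kolmogorov_distance law std_normal_distribution \<le> m"
proof -
  let ?K = "kolmogorov_distance law std_normal_distribution"
  \<comment> \<open>The numbers \<open>0.102\<close> and \<open>0.0067\<close> are upper roundings of \<open>4 / sqrt (22.88 * 68.5)\<close> and
    \<open>6 / sqrt (22.88\<^sup>3 * 68.5)\<close>, the bounds on the standard deviations of \<open>Q\<close> and \<open>T\<close>.\<close>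
  define e \<sigma> \<tau> where "e = 0.3 * m" and "\<sigma> = 0.102 * m" and "\<tau> = 0.0067 * m\<^sup>2"
  have pos: "e > 0" "\<sigma> > 0" "\<tau> > 0" using m by (auto simp: e_def \<sigma>_def \<tau>_def)
  have db0: "0 \<le> d * b" using d_ge_0 b_ge_0 by simp
  have K: "\<bar>cdf law t - std_normal_cdf t\<bar> \<le> ?K" for t
    by (rule kolmogorov_distance_upper[OF real_distribution_law real_dist_normal_dist])
  then have K0: "0 \<le> ?K" using order_trans[OF abs_ge_zero] by blast
  have \<eta>0: "0 \<le> d\<^sup>2 * A" using A_nonneg by simp
  have prod: "(d * b) ^ n * (d\<^sup>2 * A) \<le> (m / 22.88) ^ n * (m / 68.5)" for n
    using \<eta> \<delta> \<eta>0 db0 m by (intro mult_mono power_mono) auto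
  have vQ: "variance Q \<le> \<sigma>\<^sup>2"
  proof -
    have "variance Q \<le> 16 * ((d * b) ^ 1 * (d\<^sup>2 * A))"
      using variance_Q_le[OF V_nonempty] by (simp add: power2_eq_square power3_eq_cube algebra_simps)
    also have "\<dots> \<le> 16 * ((m / 22.88) ^ 1 * (m / 68.5))" using prod[of 1] by (rule mult_left_mono) simp
    also have "\<dots> = 16 / (22.88 * 68.5) * m\<^sup>2" by (simp add: power2_eq_square)
    also have "\<dots> \<le> 0.102\<^sup>2 * m\<^sup>2" by (rule mult_right_mono) (simp_all add: power2_eq_square)
    finally show ?thesis by (simp only: \<sigma>_def power_mult_distrib)
  qed
  have vT: "variance T \<le> \<tau>\<^sup>2"
  proof -
    have "variance T \<le> 36 * ((d * b) ^ 3 * (d\<^sup>2 * A))"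
      using variance_T_le[OF V_nonempty] by (simp add: power_mult_distrib power2_eq_square eval_nat_numeral algebra_simps)
    also have "\<dots> \<le> 36 * ((m / 22.88) ^ 3 * (m / 68.5))" using prod[of 3] by (rule mult_left_mono) simp
    also have "\<dots> = 36 / (22.88 ^ 3 * 68.5) * m ^ 4" by (simp add: power_divide eval_nat_numeral)
    also have "\<dots> \<le> 0.0067\<^sup>2 * m ^ 4" by (rule mult_right_mono) (use m in \<open>simp_all add: power2_eq_square eval_nat_numeral\<close>)
    also have "\<dots> = \<tau>\<^sup>2" by (simp add: \<tau>_def power2_eq_square eval_nat_numeral)
    finally show ?thesis .
  qed
  \<comment> \<open>Here \<open>0.0292\<close> is an upper rounding of \<open>2 / 68.5\<close>.\<close>
  have ET: "0 \<le> expectation T" "expectation T \<le> 0.0292 * m"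
    using expectation_T_le[OF V_nonempty] \<eta> T_nonneg m by (auto intro!: Bochner_Integration.integral_nonneg)
  \<comment> \<open>Rounded up from the terms of Stein's bound: \<open>2 * 0.102 + 5 * 0.0292 + 2 * 0.0067 + 0.0413\<close>, where the
    last number comes from the terms divided by \<open>e\<close>, as does the coefficient of \<open>K\<close>.\<close>
  define B where "B = 0.405 * m + 0.1948 * ?K"
  have stein: "\<bar>expectation (\<lambda>\<omega>. ramp z e (W \<omega>)) - ramp_mean z e\<bar> \<le> B" for z
  proof -
    let ?P = "prob {\<omega> \<in> space M. W \<omega> \<in> {z - d * b..z + e + d * b}}"
    have len: "z + e + d * b - (z - d * b) = e + 2 * (d * b)" by simp
    have "(e + 2 * x) / 2 \<le> 0.1938 * m" if "22.88 * x \<le> m" for x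
      using that m by (simp add: e_def)
    from this[OF \<delta>] have P: "?P \<le> 0.1938 * m + 2 * ?K"
      using concentration[of "z - d * b" "z + e + d * b"] db0 pos unfolding len by linarith
    have "expectation T * ?P \<le> 0.0292 * m * (0.1938 * m + 2 * ?K)"
      using ET P m by (intro mult_mono) auto
    then have "(expectation T * ?P + \<tau>) / e \<le> (0.0292 * m * (0.1938 * m + 2 * ?K) + \<tau>) / e"
      using pos by (intro divide_right_mono) auto
    also have "\<dots> = 0.0292 / 0.3 * (0.1938 * m + 2 * ?K) + 0.0067 / 0.3 * m"
      using m by (simp add: e_def \<tau>_def field_simps power2_eq_square)
    also have "\<dots> \<le> 0.0413 * m + 0.1948 * ?K" using m K0 by (simp add: field_simps)
    finally have "(expectation T * ?P + \<tau>) / e \<le> 0.0413 * m + 0.1948 * ?K" .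
    moreover have "\<tau> \<le> 0.0067 * m"
      using m by (simp add: \<tau>_def power2_eq_square mult_left_le)
    moreover note stein_bound[OF pos(1) vQ pos(2) vT pos(3), of z] ET
    ultimately show ?thesis unfolding \<sigma>_def B_def using m by simp
  qed
  have "\<bar>cdf law t - std_normal_cdf t\<bar> \<le> e / 2 + B" for t
  proof -
    \<comment> \<open>The indicator of \<open>{..t}\<close> lies between the ramps that start to fall at \<open>t - e\<close> and at \<open>t\<close>.\<close>
    have "cdf law t - std_normal_cdf t \<le> e / 2 + B"
      using expectation_ramp_bounds(1)[OF pos(1), of t] stein[of t]
        ramp_mean_bounds(2)[OF pos(1), of t] std_normal_cdf_diff_le[of e t] pos by linarith
    moreover have "std_normal_cdf t - cdf law t \<le> e / 2 + B"
      using expectation_ramp_bounds(2)[OF pos(1), of "t - e"] stein[of "t - e"]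
        ramp_mean_bounds(1)[OF pos(1), of "t - e"] std_normal_cdf_diff_le[of e "t - e"] pos
      by simp
    ultimately show ?thesis by linarith
  qed
  then have "?K \<le> e / 2 + B" by (rule kolmogorov_distance_le)
  then show ?thesis using m by (simp add: B_def e_def)
qed

end

text \<open>Distinct neighbours \<open>j\<close> of \<open>k\<close> give distinct edges at \<open>k\<close>; parallel edges and loops can only increase
  the degree.\<close>

lemma card_neighbours_le_degree:
  assumes "finite V"
  shows "card {j \<in> V. j = k \<or> Upair k j \<in># E} \<le> mg_degree E k + 1"
proof -
  let ?F = "{# e \<in># E. k \<in> set_uprod e #}"
  have "card {j \<in> V. Upair k j \<in># E} = card (Upair k ` {j \<in> V. Upair k j \<in># E})"
    by (rule card_image[symmetric]) (auto simp: inj_on_def)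
  also have "\<dots> \<le> card (set_mset ?F)" by (intro card_mono) auto
  also have "\<dots> \<le> size ?F"
    unfolding size_multiset_overloaded_eq
    using sum_mono[of "set_mset ?F" "\<lambda>_. 1" "count ?F"] by (simp add: Suc_le_eq)
  finally have *: "card {j \<in> V. Upair k j \<in># E} \<le> mg_degree E k" by (simp add: mg_degree_def)
  have "card {j \<in> V. j = k \<or> Upair k j \<in># E} \<le> card (insert k {j \<in> V. Upair k j \<in># E})"
    using assms by (intro card_mono) auto
  also have "\<dots> \<le> mg_degree E k + 1"
    using assms * by (auto simp: card_insert_if)
  finally show ?thesis .
qed

theorem theorem2p1:
  fixes M :: "'a measure"
    and V :: "'k set"
    and Y :: "'k \<Rightarrow> 'a \<Rightarrow> real"
    and c :: "'k \<Rightarrow> real"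
    and E :: "'k uprod multiset"
    and S W :: "'a \<Rightarrow> real"
    and N D :: nat
    and v A3 L :: real
  assumes "prob_space M"
    and "finite V" and "card V = N" and "N \<ge> 1"
    and "\<And>k. k \<in> V \<Longrightarrow> Y k \<in> borel_measurable M"
    and "\<And>k. k \<in> V \<Longrightarrow> integrable M (\<lambda>\<omega>. (Y k \<omega>)\<^sup>2)"
    and "dependency_graph M V Y E"
    and "mg_max_degree V E = D"
    and "S = (\<lambda>\<omega>. \<Sum>k\<in>V. Y k \<omega>)"
    and "v = sqrt (prob_space.variance M S)"
    and "A3 = (\<Sum>k\<in>V. prob_space.expectation M (\<lambda>\<omega>. \<bar>Y k \<omega> - c k\<bar> ^ 3))"
    and "v > 0"
    and "L > 0"
    and "Max ((\<lambda>k. Linf_norm M (\<lambda>\<omega>. Y k \<omega> - c k)) ` V) \<le> ereal L"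
    and "W = (\<lambda>\<omega>. (S \<omega> - prob_space.expectation M S) / v)"
  shows "kolmogorov_distance (distr M borel W) std_normal_distribution
           \<le> max (68.5 * ((real D + 1)\<^sup>2 * A3 / v ^ 3)) (22.88 * (L * (real D + 1) / v))"
proof -
  interpret prob_space M by fact
  note finV = assms(2) and Y_meas = assms(5) and v0 = assms(12) and L0 = assms(13)
  note S_def = assms(9) and W_def = assms(15)
  define b d where "b = L / v" and "d = real D + 1"
  \<comment> \<open>Clipping makes the essential bound hold at every point; as a function of single coordinates it
    preserves the dependency graph, and it changes the variables on a null set only.\<close>
  define clip where "clip k y = max (- b) (min b ((y - c k) / v))" for k y
  define Z where "Z k \<omega> = clip k (Y k \<omega>)" for k \<omega>
  define nb where "nb k = {j \<in> V. j = k \<or> Upair k j \<in># E}" for k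
  let ?m = "max (68.5 * ((real D + 1)\<^sup>2 * A3 / v ^ 3)) (22.88 * (L * (real D + 1) / v))"
  have b0: "b > 0" using L0 v0 by (simp add: b_def)
  have clip_meas [measurable]: "clip k \<in> borel_measurable borel" for k
    unfolding clip_def[abs_def] by measurable
  have Z_meas: "Z k \<in> borel_measurable M" if "k \<in> V" for k
    unfolding Z_def[abs_def] using Y_meas[OF that] by measurable
  have bounded_dep: "bounded_dependency M V nb d b Z"
  proof (unfold_locales)
    fix k assume k: "k \<in> V"
    have "mg_degree E k \<le> D"
      unfolding assms(8)[symmetric] mg_max_degree_def using k finV by (intro Max_ge) auto
    then show "real (card (nb k)) \<le> d"
      using card_neighbours_le_degree[OF finV, of k E] unfolding nb_def d_def by linarith
    show "\<bar>Z k \<omega>\<bar> \<le> b" for \<omega>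
      using b0 unfolding Z_def clip_def by linarith
  next
    fix A B assume AB: "A \<subseteq> V" "B \<subseteq> V" and sep: "\<And>p. p \<in> A \<Longrightarrow> nb p \<inter> B = {}"
    have "A \<inter> B = {}" "\<not> (\<exists>a\<in>A. \<exists>b\<in>B. Upair a b \<in># E)"
      using sep AB unfolding nb_def by blast+
    then have ind: "indep_var (PiM A (\<lambda>_. borel)) (\<lambda>\<omega>. \<lambda>k\<in>A. Y k \<omega>) (PiM B (\<lambda>_. borel)) (\<lambda>\<omega>. \<lambda>k\<in>B. Y k \<omega>)"
      using assms(7) AB unfolding dependency_graph_def by blast
    let ?g = "\<lambda>A x. \<lambda>k\<in>A. clip k (x k)"
    have g: "?g C \<in> PiM C (\<lambda>_. borel) \<rightarrow>\<^sub>M PiM C (\<lambda>_. borel)" for C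
      by (rule measurable_restrict, rule measurable_compose[OF _ clip_meas], rule measurable_component_singleton)
    have eq: "(\<lambda>\<omega>. \<lambda>k\<in>C. Z k \<omega>) = ?g C \<circ> (\<lambda>\<omega>. \<lambda>k\<in>C. Y k \<omega>)" for C
      by (auto simp: Z_def fun_eq_iff restrict_def)
    show "indep_var (PiM A (\<lambda>_. borel)) (\<lambda>\<omega>. \<lambda>k\<in>A. Z k \<omega>) (PiM B (\<lambda>_. borel)) (\<lambda>\<omega>. \<lambda>k\<in>B. Z k \<omega>)"
      unfolding eq by (rule indep_var_compose[OF ind g g])
  next
    fix k j assume "k \<in> V" "j \<in> nb k"
    moreover have "Upair k j \<in># E \<longleftrightarrow> Upair j k \<in># E"
      by (rule arg_cong[where f = "\<lambda>e. e \<in># E"]) simp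
    ultimately show "k \<in> nb j" unfolding nb_def by auto
  qed (use finV Z_meas in \<open>auto simp: nb_def\<close>)
  have AE_Z: "AE \<omega> in M. Z k \<omega> = (Y k \<omega> - c k) / v" if k: "k \<in> V" for k
  proof -
    have Linf: "Linf_norm M (\<lambda>\<omega>. Y k \<omega> - c k) \<le> ereal L"
      using assms(14) finV k by (metis (no_types, lifting) Max_ge finite_imageI imageI order_trans)
    have "AE \<omega> in M. ereal \<bar>Y k \<omega> - c k\<bar> \<le> ereal L"
      by (rule eventually_mono[OF esssup_AE]) (rule order_trans[OF _ Linf[unfolded Linf_norm_def]])
    then show ?thesis
    proof eventually_elim
      case (elim \<omega>)
      then have "\<bar>(Y k \<omega> - c k) / v\<bar> \<le> b" using v0 by (simp add: b_def divide_right_mono)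
      then show ?case unfolding Z_def clip_def by linarith
    qed
  qed
  interpret Z: bounded_dependency M V nb d b Z by (rule bounded_dep)
  have intY: "integrable M (Y k)" if "k \<in> V" for k
    by (rule square_integrable_imp_integrable[OF Y_meas assms(6)]) (fact that)+
  have EZ: "expectation (Z k) = (expectation (Y k) - c k) / v" if k: "k \<in> V" for k
  proof -
    note Y_meas[OF k, measurable]
    have "expectation (Z k) = expectation (\<lambda>\<omega>. (Y k \<omega> - c k) / v)"
      by (rule integral_cong_AE[OF Z_meas[OF k] _ AE_Z[OF k]]) measurable
    also have "\<dots> = (expectation (Y k) - c k) / v" using intY[OF k] prob_space by simp
    finally show ?thesis .
  qed
  have S_meas [measurable]: "S \<in> borel_measurable M" unfolding S_def using Y_meas by measurable
  have W_meas [measurable]: "W \<in> borel_measurable M" unfolding W_def by measurable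
  have ES: "expectation S = (\<Sum>k\<in>V. expectation (Y k))"
    unfolding S_def by (intro Bochner_Integration.integral_sum intY)
  have sum_meas: "(\<lambda>\<omega>. \<Sum>k\<in>V. Z.X k \<omega>) \<in> borel_measurable M"
    using Z.X_measurable by measurable
  have AE_W: "AE \<omega> in M. (\<Sum>k\<in>V. Z.X k \<omega>) = W \<omega>"
  proof -
    have "AE \<omega> in M. \<forall>k\<in>V. Z k \<omega> = (Y k \<omega> - c k) / v"
      using AE_Z by (intro AE_finite_allI finV) auto
    then show ?thesis
    proof eventually_elim
      case (elim \<omega>)
      have "(\<Sum>k\<in>V. Z.X k \<omega>) = (\<Sum>k\<in>V. (Y k \<omega> - expectation (Y k)) / v)"
        using elim by (intro sum.cong) (auto simp: Z.X_def EZ diff_divide_distrib)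
      also have "\<dots> = W \<omega>"
        unfolding W_def ES by (simp add: S_def sum_divide_distrib[symmetric] sum_subtractf)
      finally show ?case .
    qed
  qed
  have var: "variance S = v\<^sup>2" using assms(10) v0 by simp
  interpret Z: normalized_dependency M V nb d b Z
  proof
    have "expectation (\<lambda>\<omega>. (\<Sum>k\<in>V. Z.X k \<omega>)\<^sup>2) = expectation (\<lambda>\<omega>. (W \<omega>)\<^sup>2)"
      by (rule integral_cong_AE) (use sum_meas AE_W in auto)
    also have "\<dots> = variance S / v\<^sup>2" by (simp add: W_def power_divide)
    also have "\<dots> = 1" using var v0 by simp
    finally show "expectation (\<lambda>\<omega>. (\<Sum>k\<in>V. Z.X k \<omega>)\<^sup>2) = 1" .
  qed
  have law: "Z.law = distr M borel W"
    by (rule distr_cong_AE) (use AE_W in \<open>auto simp: Z.W_def\<close>)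
  have "Z.A = A3 / v ^ 3"
  proof -
    have "Z.a k = expectation (\<lambda>\<omega>. \<bar>Y k \<omega> - c k\<bar> ^ 3) / v ^ 3" if k: "k \<in> V" for k
    proof -
      note Y_meas[OF k, measurable] Z_meas[OF k, measurable]
      have "Z.a k = expectation (\<lambda>\<omega>. \<bar>Y k \<omega> - c k\<bar> ^ 3 / v ^ 3)"
        unfolding Z.a_def
      proof (rule integral_cong_AE)
        show "AE \<omega> in M. \<bar>Z k \<omega>\<bar> ^ 3 = \<bar>Y k \<omega> - c k\<bar> ^ 3 / v ^ 3"
          using AE_Z[OF k] by eventually_elim (use v0 in \<open>simp add: power_divide\<close>)
      qed measurable
      then show ?thesis by simp
    qed
    then show ?thesis by (simp add: Z.A_def assms(11) sum_divide_distrib)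
  qed
  then have \<eta>: "68.5 * (d\<^sup>2 * Z.A) \<le> ?m" by (simp add: d_def)
  have \<delta>: "22.88 * (d * b) \<le> ?m" by (simp add: d_def b_def mult.commute)
  have m0: "0 < ?m" using L0 v0 by (simp add: less_max_iff_disj)
  show ?thesis
  \<comment> \<open>The bound is trivial when the right-hand side is at least \<open>1\<close>.\<close>
  proof (cases "?m < 1")
    case True
    show ?thesis using Z.kolmogorov_distance_law_le[OF m0 True \<eta> \<delta>] by (simp add: law)
  next
    case False
    interpret W: real_distribution "distr M borel W" by (rule real_distribution_distr) measurable
    have "kolmogorov_distance (distr M borel W) std_normal_distribution \<le> 1"
    proof (rule kolmogorov_distance_le)
      show "\<bar>cdf (distr M borel W) t - std_normal_cdf t\<bar> \<le> 1" for t
        using W.cdf_nonneg[of t] W.cdf_bounded_prob[of t] std_normal.cdf_nonneg[of t]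
          std_normal.cdf_bounded_prob[of t] by linarith
    qed
    then show ?thesis using False by linarith
  qed
qed

end
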